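(* Let $0<\Lambda<\infty$, let $m\ge 1$ be an integer and let $b_0,b_1,\ldots,b_{2m}$ be real numbers such that $\det\Gamma_m>0$, where $\Gamma_m=(b_{j+k})_{j,k=0}^m$, and such that: a) $\Gamma_m$ is non-negative; b) for any $0\le r\le m-1$ and any $\xi_0,\ldots,\xi_r\in\mathbb{C}$, $\sum_{j,k=0}^{r} b_{j+k}\xi_k\overline{\xi_j}=0$ implies $\sum_{j,k=0}^{r} b_{j+k+2}\xi_k\overline{\xi_j}=0$; c) the matrix $\Gamma_{m-1}^{(1)}=(b_{j+k+1})_{j,k=0}^{m-1}$ is non-negative, and for any $0\le r\le m-1$ and any $\xi_0,\ldots,\xi_r\in\mathbb{C}$, $\sum_{j,k=0}^{r} b_{j+k+1}\xi_k\overline{\xi_j}=0$ implies $\sum_{j,k=0}^{r} b_{j+k+2}\xi_k\overline{\xi_j}=0$. Then there is at least one solution of the truncated Stieltjes problem for $b_0,\ldots,b_{2m}$ with non-negative measure concentrated on the interval $[0,\Lambda]$ (i.e. there is a solution of the truncated Hausdorff problem for the interval $[0,\Lambda]$) if and only if the matrix $\Lambda\,\Gamma_{m-1}-\Gamma_{m-1}^{(1)}$, with $\Gamma_{m-1}=(b_{j+k})_{j,k=0}^{m-1}$, is non-negative and for any $\lambda\ge\Lambda$ the inequality $$\sqrt{\frac{\Delta_m\,\Delta_{m-2}^{1}}{\Delta_{m-1}\,\Delta_{m-1}^{1}}}\;\frac{d_{m-1}^{1}(\lambda)}{d_m(\lambda)}\le 1$$ holds. Moreover, if $b_0,\ldots,b_{2m}$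 satisfy $\det\Gamma_m>0$ and conditions a)–c), the matrix $\Lambda\Gamma_{m-1}-\Gamma_{m-1}^{(1)}$ is non-negative, and $$\sqrt{\frac{\Delta_m\,\Delta_{m-2}^{1}}{\Delta_{m-1}\,\Delta_{m-1}^{1}}}\;\frac{d_{m-1}^{1}(\lambda)}{d_m(\lambda)}\le 1\quad\text{for all }\lambda\ge\Lambda,$$ then the truncated Hausdorff problem has a unique solution if and only if $$\sqrt{\frac{\Delta_m\,\Delta_{m-2}^{1}}{\Delta_{m-1}\,\Delta_{m-1}^{1}}}\;\frac{d_{m-1}^{1}(\Lambda)}{d_m(\Lambda)}=1.$$
   Context: A Hermitian matrix is non-negative if its quadratic form takes only values $\ge 0$. Truncated Stieltjes problem for $b_0,\ldots,b_{2m}$: find non-decreasing $\sigma$ (equivalently, non-negative measures $d\sigma$ on $[0,\infty)$) with $\int_0^\infty t^k\,d\sigma(t)=b_k$, $k=0,\ldots,2m$. Truncated Hausdorff problem for $[0,\Lambda]$: find non-negative measures $d\sigma$ concentrated on the closed interval $[0,\Lambda]$ with $\int_0^\Lambda t^k\,d\sigma(t)=b_k$, $k=0,\ldots,2m$. Solutions are identified when they define the same measure. Put $\Delta_k=\det(b_{p+q})_{p,q=0}^{k}$. The orthogonal polynomials for $b_0,\ldots,b_{2m}$ are $$d_0(t)=\frac{1}{\sqrt{b_0}},\qquad d_k(t)=\frac{1}{\sqrt{\Delta_k\Delta_{k-1}}}\det\begin{pmatrix} b_0&b_1&\cdots&b_k\\ b_1&b_2&\cdots&b_{k+1}\\ \vdots&\vdots&&\vdots\\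 b_{k-1}&b_k&\cdots&b_{2k-1}\\ 1&t&\cdots&t^k\end{pmatrix},\quad k=1,\ldots,m.$$ Put $b^1_k=b_{k+1}$ for $k=0,\ldots,2m-2$, and let $\Delta_k^1=\det(b^1_{p+q})_{p,q=0}^k$ and $d_k^1$, $k=0,\ldots,m-1$, be defined by the same formulas with the $b_j$ replaced by the $b_j^1$ (and $\Delta_k$ by $\Delta_k^1$). By convention $\Delta^1_{-1}=1$. *)

theory Defs
  imports "HOL-Analysis.Set_Integral" "Jordan_Normal_Form.Schur_Decomposition"
begin

text \<open>Matrices are those of Jordan_Normal_Form. Some names (\<open>mat\<close>, \<open>det\<close>) also exist in HOL-Analysis,
  hence the qualified names.\<close>

text \<open>In the order on \<^typ>\<open>complex\<close>, \<^term>\<open>0 \<le> (z :: complex)\<close> means that \<open>z\<close> is real and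
  nonnegative.\<close>

definition nonneg_mat :: "complex mat \<Rightarrow> bool" where
  "nonneg_mat A \<longleftrightarrow> square_mat A \<and> mat_adjoint A = A \<and>
     (\<forall>v \<in> carrier_vec (dim_row A). 0 \<le> (A *\<^sub>v v) \<bullet>c v)"

text \<open>The moments \<open>b\<^sub>0, \<dots>, b\<^sub>2\<^sub>m\<close> are the initial values of a function \<open>b\<close> on the naturals; later
  values are never used. \<open>hankel b n\<close> has order \<open>n + 1\<close>: it is \<open>(b (j + k))\<close> for \<open>j, k = 0, \<dots>, n\<close>.\<close>

definition hankel :: "(nat \<Rightarrow> real) \<Rightarrow> nat \<Rightarrow> real mat" where
  "hankel b n = Matrix.mat (n + 1) (n + 1) (\<lambda>(j, k). b (j + k))"

definition shift :: "(nat \<Rightarrow> real) \<Rightarrow> nat \<Rightarrow> real" where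
  "shift b k = b (k + 1)"

definition Delta :: "(nat \<Rightarrow> real) \<Rightarrow> int \<Rightarrow> real" where
  "Delta b k = (if k < 0 then 1 else Determinant.det (hankel b (nat k)))"

definition orth_poly :: "(nat \<Rightarrow> real) \<Rightarrow> nat \<Rightarrow> real \<Rightarrow> real" where
  "orth_poly b k t =
     (if k = 0 then 1 / sqrt (b 0)
      else 1 / sqrt (Delta b (int k) * Delta b (int k - 1)) *
           Determinant.det (Matrix.mat (k + 1) (k + 1) (\<lambda>(i, j). if i < k then b (i + j) else t ^ j)))"

text \<open>At a zero of \<open>orth_poly b m\<close> the value of this quotient is \<open>0\<close>. A requirement that it be \<open>\<le> 1\<close>
  on all of \<open>[\<Lambda>, \<infinity>)\<close> nevertheless fails if there is a zero in \<open>[\<Lambda>, \<infinity>)\<close>, because (for positive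
  definite Hankel matrices) the quotient tends to \<open>+\<infinity>\<close> from the right at each zero of the denominator.\<close>

definition poly_ratio :: "(nat \<Rightarrow> real) \<Rightarrow> nat \<Rightarrow> real \<Rightarrow> real" where
  "poly_ratio b m x =
     sqrt (Delta b (int m) * Delta (shift b) (int m - 2) /
           (Delta b (int m - 1) * Delta (shift b) (int m - 1))) *
     (orth_poly (shift b) (m - 1) x / orth_poly b m x)"

text \<open>Solutions are Borel measures on the line rather than distribution functions, so that equality
  of solutions is equality of measures. Finiteness is the case \<open>k = 0\<close> of integrability.\<close>

definition stieltjes_solution :: "(nat \<Rightarrow> real) \<Rightarrow> nat \<Rightarrow> real measure \<Rightarrow> bool" where
  "stieltjes_solution b m M \<longleftrightarrow>
     sets M = sets borel \<and> emeasure M (- {0..}) = 0 \<and>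
     (\<forall>k \<le> 2 * m. set_integrable M {0..} (\<lambda>t. t ^ k) \<and> (LINT t:{0..}|M. t ^ k) = b k)"

definition hausdorff_solution :: "real \<Rightarrow> (nat \<Rightarrow> real) \<Rightarrow> nat \<Rightarrow> real measure \<Rightarrow> bool" where
  "hausdorff_solution L b m M \<longleftrightarrow>
     sets M = sets borel \<and> emeasure M (- {0..L}) = 0 \<and>
     (\<forall>k \<le> 2 * m. set_integrable M {0..L} (\<lambda>t. t ^ k) \<and> (LINT t:{0..L}|M. t ^ k) = b k)"

end

theory Submission
  imports Defs "HOL-Computational_Algebra.Fundamental_Theorem_Algebra"
begin

text \<open>Let \<open>B\<close> be the functional \<open>t\<^sup>k \<mapsto> b\<^sub>k\<close> on polynomials, \<open>D\<^sub>m\<close> and \<open>D\<^sup>1\<^sub>m\<^sub>-\<^sub>1\<close> the determinants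
  in the definitions of \<open>d\<^sub>m\<close> and \<open>d\<^sup>1\<^sub>m\<^sub>-\<^sub>1\<close>, and \<open>F = \<Delta>\<^sup>1\<^sub>m\<^sub>-\<^sub>1 D\<^sub>m - \<Delta>\<^sub>m D\<^sup>1\<^sub>m\<^sub>-\<^sub>1\<close>. One minus the quotient in the
  theorem equals \<open>F / (\<Delta>\<^sup>1\<^sub>m\<^sub>-\<^sub>1 D\<^sub>m)\<close>, and \<open>F\<close> is the orthogonal polynomial of degree \<open>m\<close> for the
  functional \<open>p \<mapsto> B(t p)\<close>. Hence \<open>F\<close> has \<open>m\<close> simple positive zeros, which together with \<open>0\<close> are the nodes
  of a Gauss--Radau quadrature formula with positive weights that is exact up to degree \<open>2m\<close>. It solves
  the problem on \<open>[0, L]\<close> as soon as all zeros of \<open>F\<close> are at most \<open>L\<close>, which the two conditions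
  force. Conversely, a zero \<open>z\<close> of \<open>F = (t - z) p\<close> satisfies \<open>B(t (t - z) p\<^sup>2) = 0\<close>, so \<open>z \<le> L\<close> if
  \<open>B\<close> is nonnegative on polynomials that are nonnegative on \<open>[0, L]\<close>.

  If \<open>F(L) = 0\<close>, then \<open>B(t (L - t) p\<^sup>2) = 0\<close> for \<open>F = (t - L) p\<close>, and every solution is supported on the
  \<open>m + 1\<close> nodes; this determines it. Otherwise no node is \<open>L\<close>, and the Gauss--Radau formula with
  prescribed node \<open>L\<close> is a second solution.\<close>

section \<open>The moment functional and determinantal orthogonal polynomials\<close>

definition mom :: "(nat \<Rightarrow> real) \<Rightarrow> real poly \<Rightarrow> real" where
  "mom c p = (\<Sum>i\<le>degree p. coeff p i * c i)"

lemma mom_altdef: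
  assumes "degree p \<le> n"
  shows "mom c p = (\<Sum>i\<le>n. coeff p i * c i)"
  unfolding mom_def using assms
  by (intro sum.mono_neutral_left) (auto simp: coeff_eq_0)

lemma mom_add: "mom c (p + q) = mom c p + mom c q"
proof -
  let ?n = "max (degree p) (degree q)"
  have "degree (p + q) \<le> ?n" by (rule degree_add_le_max)
  then show ?thesis
    by (simp add: mom_altdef[of _ ?n] algebra_simps sum.distrib)
qed

lemma mom_smult: "mom c (Polynomial.smult a p) = a * mom c p"
  by (subst mom_altdef[of _ "degree p"]) (auto simp: mom_def sum_distrib_left mult_ac degree_smult_le)

lemma mom_0 [simp]: "mom c 0 = 0"
  by (simp add: mom_def)

lemma mom_minus: "mom c (- p) = - mom c p"
  using mom_smult[of c "-1" p] by simp

lemma mom_diff: "mom c (p - q) = mom c p - mom c q"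
  using mom_add[of c p "- q"] by (simp add: mom_minus)

lemma mom_sum: "mom c (\<Sum>i\<in>A. f i) = (\<Sum>i\<in>A. mom c (f i))"
  by (induction A rule: infinite_finite_induct) (auto simp: mom_add)

lemma mom_monom: "mom c (Polynomial.monom a n) = a * c n"
  by (subst mom_altdef[of _ n]) (auto simp: degree_monom_le if_distrib[of "\<lambda>x. x * _"] cong: if_cong)

text \<open>Multiplying by a fixed polynomial \<open>g\<close> before applying \<open>B\<close>
  gives again the functional of a moment sequence. The weights needed are \<open>g = t\<close> and
  \<open>g = L - t\<close>.\<close>

lemma mom_moments_of_linear:
  assumes "\<And>k. c k = mom b (g * Polynomial.monom 1 k)"
  shows "mom c p = mom b (g * p)"
proof -
  have "p = (\<Sum>i\<le>degree p. Polynomial.smult (coeff p i) (Polynomial.monom 1 i))"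
    by (simp add: smult_monom poly_as_sum_of_monoms)
  then have "g * p = (\<Sum>i\<le>degree p. Polynomial.smult (coeff p i) (g * Polynomial.monom 1 i))"
    by (metis (no_types, lifting) mult_smult_right sum.cong sum_distrib_left)
  then show ?thesis
    by (simp add: mom_sum mom_smult mom_def[of c] assms)
qed

lemma mom_shift: "mom (shift b) p = mom b ([:0, 1:] * p)"
  by (rule mom_moments_of_linear)
    (simp add: shift_def mom_monom flip: monom_Suc)

lemma mom_monom_mult:
  "mom c (p * Polynomial.monom 1 i) = (\<Sum>j\<le>degree p. coeff p j * c (i + j))"
proof -
  have "p * Polynomial.monom 1 i = (\<Sum>j\<le>degree p. Polynomial.monom (coeff p j) j) * Polynomial.monom 1 i"
    by (simp add: poly_as_sum_of_monoms)
  also have "\<dots> = (\<Sum>j\<le>degree p. Polynomial.monom (coeff p j) (i + j))"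
    by (simp add: sum_distrib_right mult_monom add.commute)
  finally show ?thesis by (simp add: mom_sum mom_monom)
qed

text \<open>The last row is kept free: powers of t give the determinant in \<open>orth_poly\<close>,
  while a row of moments expresses the pairing of that polynomial with a monomial.\<close>

definition bordered :: "(nat \<Rightarrow> real) \<Rightarrow> nat \<Rightarrow> (nat \<Rightarrow> real) \<Rightarrow> real mat" where
  "bordered c k r = Matrix.mat (k + 1) (k + 1) (\<lambda>(i, j). if i < k then c (i + j) else r j)"

text \<open>The unnormalised orthogonal polynomial D_k, expanded along its last row. The zero row is
  only a placeholder, since cofactors of row \<open>k\<close> do not depend on that row.\<close>

definition hankel_poly :: "(nat \<Rightarrow> real) \<Rightarrow> nat \<Rightarrow> real poly" where
  "hankel_poly c k = (\<Sum>j\<le>k. Polynomial.monom (cofactor (bordered c k (\<lambda>_. 0)) k j) j)"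

lemma det_bordered:
  "Determinant.det (bordered c k r) = (\<Sum>j\<le>k. r j * cofactor (bordered c k (\<lambda>_. 0)) k j)"
proof -
  have "cofactor (bordered c k r) k j = cofactor (bordered c k (\<lambda>_. 0)) k j" for j
    unfolding cofactor_def mat_delete_def
    by (rule arg_cong[where f = "\<lambda>A. (- 1) ^ (k + j) * Determinant.det A"])
      (auto simp: bordered_def intro!: eq_matI)
  moreover have "Determinant.det (bordered c k r) =
      (\<Sum>j<Suc k. bordered c k r $$ (k, j) * cofactor (bordered c k r) k j)"
    by (rule laplace_expansion_row) (auto simp: bordered_def)
  ultimately show ?thesis
    by (auto simp: bordered_def lessThan_Suc_atMost intro!: sum.cong)
qed

lemma poly_hankel_poly:
  "poly (hankel_poly c k) t = Determinant.det (bordered c k (\<lambda>j. t ^ j))"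
  by (simp add: det_bordered hankel_poly_def poly_sum poly_monom mult.commute)

lemma degree_hankel_poly_le: "degree (hankel_poly c k) \<le> k"
  unfolding hankel_poly_def
  by (intro degree_sum_le) (auto intro: order_trans[OF degree_monom_le])

lemma coeff_hankel_poly:
  "j \<le> k \<Longrightarrow> coeff (hankel_poly c k) j = cofactor (bordered c k (\<lambda>_. 0)) k j"
  by (simp add: hankel_poly_def coeff_sum if_distrib cong: if_cong)

lemma lead_coeff_hankel_poly: "coeff (hankel_poly c k) k = Delta c (int k - 1)"
proof (cases k)
  case 0
  then show ?thesis
    by (simp add: coeff_hankel_poly cofactor_def Delta_def mat_delete_def bordered_def)
next
  case (Suc l)
  have "mat_delete (bordered c k (\<lambda>_. 0)) k k = hankel c l"
    using Suc by (auto simp: mat_delete_def bordered_def hankel_def intro!: eq_matI)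
  with Suc show ?thesis
    by (simp add: coeff_hankel_poly cofactor_def Delta_def)
qed

text \<open>Pairing with t^i turns the last row of powers into the moments c_i, ..., c_(i+k). For i
  < k this repeats row i; for i = k it completes the Hankel matrix.\<close>

lemma mom_hankel_poly_monom:
  assumes "i \<le> k"
  shows "mom c (hankel_poly c k * Polynomial.monom 1 i) = (if i = k then Delta c (int k) else 0)"
proof -
  have "mom c (hankel_poly c k * Polynomial.monom 1 i) =
      (\<Sum>j\<le>k. c (i + j) * cofactor (bordered c k (\<lambda>_. 0)) k j)"
    unfolding mom_monom_mult
  proof -
    have "(\<Sum>j\<le>degree (hankel_poly c k). coeff (hankel_poly c k) j * c (i + j)) =
        (\<Sum>j\<le>k. coeff (hankel_poly c k) j * c (i + j))"
      using degree_hankel_poly_le by (intro sum.mono_neutral_left) (auto simp: coeff_eq_0)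
    then show "(\<Sum>j\<le>degree (hankel_poly c k). coeff (hankel_poly c k) j * c (i + j)) =
        (\<Sum>j\<le>k. c (i + j) * cofactor (bordered c k (\<lambda>_. 0)) k j)"
      by (simp add: coeff_hankel_poly mult.commute)
  qed
  also have "\<dots> = Determinant.det (bordered c k (\<lambda>j. c (i + j)))"
    by (simp add: det_bordered)
  also have "\<dots> = (if i = k then Delta c (int k) else 0)"
  proof (cases "i = k")
    case True
    then have "bordered c k (\<lambda>j. c (i + j)) = hankel c k"
      by (auto simp: bordered_def hankel_def intro!: eq_matI) (metis less_SucE)
    with True show ?thesis by (simp add: Delta_def)
  next
    case False
    with assms have "Determinant.det (bordered c k (\<lambda>j. c (i + j))) = 0"
      by (intro det_identical_rows[of _ "k + 1" i k])
        (auto simp: bordered_def intro!: eq_vecI)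
    with False show ?thesis by simp
  qed
  finally show ?thesis .
qed

lemma mom_hankel_poly:
  assumes "degree q \<le> k"
  shows "mom c (hankel_poly c k * q) = coeff q k * Delta c (int k)"
proof -
  have "q = (\<Sum>i\<le>k. Polynomial.smult (coeff q i) (Polynomial.monom 1 i))"
    using assms by (simp add: smult_monom poly_as_sum_of_monoms')
  then have "hankel_poly c k * q =
      (\<Sum>i\<le>k. Polynomial.smult (coeff q i) (hankel_poly c k * Polynomial.monom 1 i))"
    by (metis (no_types, lifting) mult_smult_right sum.cong sum_distrib_left)
  then show ?thesis
    by (simp add: mom_sum mom_smult mom_hankel_poly_monom if_distrib cong: if_cong)
qed

definition pos_up_to :: "(nat \<Rightarrow> real) \<Rightarrow> nat \<Rightarrow> bool" where
  "pos_up_to c n \<longleftrightarrow> (\<forall>p. p \<noteq> 0 \<and> degree p \<le> n \<longrightarrow> mom c (p * p) > 0)"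

lemma pos_up_toD: "pos_up_to c n \<Longrightarrow> p \<noteq> 0 \<Longrightarrow> degree p \<le> n \<Longrightarrow> mom c (p * p) > 0"
  by (simp add: pos_up_to_def)

lemma pos_up_to_nonneg: "pos_up_to c n \<Longrightarrow> degree p \<le> n \<Longrightarrow> mom c (p * p) \<ge> 0"
  by (cases "p = 0") (auto dest: pos_up_toD)

text \<open>Induction on the order: D_(l+1) has leading coefficient Delta_l > 0, and the functional
  takes the value Delta_l * Delta_(l+1) on its square.\<close>

lemma Delta_pos:
  assumes "pos_up_to c n" "k \<le> int n"
  shows "Delta c k > 0"
proof (cases "k < 0")
  case False
  have "int l \<le> int n \<Longrightarrow> Delta c (int l) > 0" for l
  proof (induction l)
    case 0
    have "mom c (1 * 1) > 0"
      by (rule pos_up_toD[OF assms(1)]) auto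
    then show ?case
      by (simp add: mom_def Delta_def hankel_def det_single)
  next
    case (Suc l)
    let ?D = "hankel_poly c (Suc l)"
    from Suc have D: "coeff ?D (Suc l) > 0"
      by (simp add: lead_coeff_hankel_poly)
    then have "mom c (?D * ?D) > 0"
      using Suc.prems by (intro pos_up_toD[OF assms(1)] order_trans[OF degree_hankel_poly_le]) auto
    with D show ?case
      by (simp add: mom_hankel_poly degree_hankel_poly_le zero_less_mult_iff)
  qed
  from this[of "nat k"] False assms(2) show ?thesis by simp
qed (simp add: Delta_def)

text \<open>The leading coefficient is Delta_(k-1), so positivity up to degree k - 1 is enough; this
  is why \<open>Suc n\<close> is allowed.\<close>

lemma degree_hankel_poly:
  assumes "pos_up_to c n" "k \<le> Suc n"
  shows "degree (hankel_poly c k) = k"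
proof -
  have "coeff (hankel_poly c k) k > 0"
    using assms by (simp add: lead_coeff_hankel_poly Delta_pos)
  then show ?thesis
    using degree_hankel_poly_le[of c k] le_degree[of "hankel_poly c k" k] by auto
qed

section \<open>Zeros of orthogonal polynomials\<close>

lemma poly_sum_atMost:
  fixes p :: "'a :: comm_semiring_1 poly"
  assumes "degree p \<le> n"
  shows "poly p x = (\<Sum>i\<le>n. coeff p i * x ^ i)"
  unfolding poly_altdef using assms
  by (intro sum.mono_neutral_left) (auto simp: coeff_eq_0)

text \<open>Write Q = (t - z)(u + iv) with real u, v. Comparing real and imaginary parts gives Q v =
  Im z * (u^2 + v^2). The left side is annihilated by orthogonality, which forces u = v = 0 unless z
  is real.\<close>

lemma orthogonal_poly_complex_roots_real:
  fixes z :: complex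
  assumes c: "pos_up_to c (m - 1)" and Q: "degree Q = m" "m \<ge> 1"
    and orth: "\<And>s. degree s < m \<Longrightarrow> mom c (Q * s) = 0"
    and z: "poly (map_poly complex_of_real Q) z = 0"
  shows "Im z = 0"
proof (rule ccontr)
  assume nz: "Im z \<noteq> 0"
  obtain P where P: "map_poly complex_of_real Q = [:- z, 1:] * P"
    using z poly_eq_0_iff_dvd by (metis dvdE)
  have "Q \<noteq> 0" using Q by auto
  then have "P \<noteq> 0" using P by (metis map_poly_eq_0_iff mult_zero_right of_real_0 of_real_eq_0_iff)
  have "m = degree ([:- z, 1:] * P)"
    unfolding P[symmetric] using Q by (simp add: degree_map_poly)
  also have "\<dots> = Suc (degree P)"
    using \<open>P \<noteq> 0\<close> by (subst degree_mult_eq) auto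
  finally have dP: "degree P = m - 1" by simp
  define u where "u = map_poly Re P"
  define v where "v = map_poly Im P"
  have duv: "degree u \<le> m - 1" "degree v \<le> m - 1"
    using map_poly_degree_leq[of Re P] map_poly_degree_leq[of Im P]
    by (auto simp: u_def v_def dP)
  have Puv: "poly P (complex_of_real t) = Complex (poly u t) (poly v t)" for t
  proof -
    have "poly P (complex_of_real t) = (\<Sum>i\<le>m - 1. coeff P i * complex_of_real t ^ i)"
      by (simp add: poly_altdef dP)
    moreover have "poly u t = (\<Sum>i\<le>m - 1. Re (coeff P i) * t ^ i)"
      unfolding poly_sum_atMost[OF duv(1)] by (simp add: u_def coeff_map_poly)
    moreover have "poly v t = (\<Sum>i\<le>m - 1. Im (coeff P i) * t ^ i)"
      unfolding poly_sum_atMost[OF duv(2)] by (simp add: v_def coeff_map_poly)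
    ultimately show ?thesis
      by (simp add: complex_eq_iff flip: of_real_power)
  qed
  have eq: "complex_of_real (poly Q t) = (complex_of_real t - z) * Complex (poly u t) (poly v t)" for t
  proof -
    have "complex_of_real (poly Q t) = poly (map_poly complex_of_real Q) (complex_of_real t)"
      by (simp)
    also have "\<dots> = (complex_of_real t - z) * poly P (complex_of_real t)"
      by (simp add: P algebra_simps)
    finally show ?thesis by (simp add: Puv)
  qed
  have "Q = [:- Re z, 1:] * u + Polynomial.smult (Im z) v"
  proof (rule poly_ext)
    fix t show "poly Q t = poly ([:- Re z, 1:] * u + Polynomial.smult (Im z) v) t"
      using arg_cong[OF eq[of t], of Re] by (simp add: algebra_simps)
  qed
  moreover have im: "[:- Re z, 1:] * v = Polynomial.smult (Im z) u"
  proof (rule poly_ext)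
    fix t show "poly ([:- Re z, 1:] * v) t = poly (Polynomial.smult (Im z) u) t"
      using arg_cong[OF eq[of t], of Im] by (simp add: algebra_simps)
  qed
  ultimately have "Q * v = u * ([:- Re z, 1:] * v) + Polynomial.smult (Im z) (v * v)"
    by (simp only: ring_distribs mult_smult_left mult_smult_right mult_ac)
  then have "Q * v = Polynomial.smult (Im z) (u * u + v * v)"
    by (simp only: im mult_smult_right smult_add_right)
  moreover have "mom c (Q * v) = 0"
    using duv Q by (intro orth) linarith
  ultimately have "mom c (u * u) + mom c (v * v) = 0"
    using nz by (simp add: mom_smult mom_add)
  moreover have "mom c (u * u) \<ge> 0" "mom c (v * v) \<ge> 0"
    using duv by (auto intro: pos_up_to_nonneg[OF c])
  ultimately have "mom c (u * u) = 0" "mom c (v * v) = 0" by auto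
  then have "u = 0" "v = 0"
    using pos_up_toD[OF c] duv by force+
  then have "poly Q t = 0" for t
    using arg_cong[OF eq[of t], of Re] by simp
  with \<open>Q \<noteq> 0\<close> show False
    using poly_all_0_iff_0 by blast
qed

text \<open>At a multiple zero, Q = (t - x) p and p = (t - x) r, hence Q r = p^2. Orthogonality
  makes the functional vanish on it, positivity makes it positive.\<close>

lemma orthogonal_poly_simple_root:
  assumes c: "pos_up_to c (m - 1)" and Q: "degree Q = m" "m \<ge> 1"
    and orth: "\<And>s. degree s < m \<Longrightarrow> mom c (Q * s) = 0"
    and x: "poly Q x = 0"
  shows "poly (pderiv Q) x \<noteq> 0"
proof
  assume x': "poly (pderiv Q) x = 0"
  obtain p where p: "Q = [:- x, 1:] * p"
    using x by (metis poly_eq_0_iff_dvd dvdE)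
  have "poly (pderiv Q) x = poly p x"
    unfolding p pderiv_mult by (simp add: pderiv_pCons)
  with x' have "poly p x = 0" by simp
  then obtain r where r: "p = [:- x, 1:] * r"
    by (metis poly_eq_0_iff_dvd dvdE)
  have "p \<noteq> 0" "r \<noteq> 0" using Q p r by auto
  then have "degree p = m - 1" "degree r < m"
    using Q p r degree_mult_eq[of "[:- x, 1:]" p] degree_mult_eq[of "[:- x, 1:]" r] by auto
  then have "mom c (p * p) > 0" "mom c (Q * r) = 0"
    using pos_up_toD[OF c \<open>p \<noteq> 0\<close>] orth by auto
  moreover have "Q * r = p * ([:- x, 1:] * r)" by (simp only: p mult_ac)
  ultimately show False by (simp only: r[symmetric])
qed

text \<open>Over the complex numbers Q splits into m distinct linear factors because its zeros are
  simple, and all of these zeros are real.\<close>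

lemma orthogonal_poly_card_roots:
  assumes c: "pos_up_to c (m - 1)" and Q: "degree Q = m" "m \<ge> 1"
    and orth: "\<And>s. degree s < m \<Longrightarrow> mom c (Q * s) = 0"
  shows "card {x. poly Q x = 0} = m"
proof -
  let ?Q = "map_poly complex_of_real Q"
  note real = orthogonal_poly_complex_roots_real[OF c Q orth]
  have Q0: "Q \<noteq> 0" using Q by auto
  have "rsquarefree ?Q"
    unfolding rsquarefree_roots
  proof (intro allI notI)
    fix z assume z: "poly ?Q z = 0 \<and> poly (pderiv ?Q) z = 0"
    with real have "z = complex_of_real (Re z)" by (simp add: complex_eq_iff)
    then obtain x where x: "z = complex_of_real x" by blast
    have "pderiv ?Q = map_poly complex_of_real (pderiv Q)"
      by (auto simp: poly_eq_iff coeff_pderiv coeff_map_poly)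
    with z x have "poly Q x = 0" "poly (pderiv Q) x = 0" by auto
    then show False
      using orthogonal_poly_simple_root[OF c Q orth] by blast
  qed
  then have "Polynomial.smult (lead_coeff ?Q) (\<Prod>z | poly ?Q z = 0. [:- z, 1:]) = ?Q"
    by (rule complex_poly_decompose_rsquarefree)
  then have "degree ?Q = degree (Polynomial.smult (lead_coeff ?Q) (\<Prod>z | poly ?Q z = 0. [:- z, 1:]))"
    by simp
  also have "\<dots> = card {z. poly ?Q z = 0}"
    using Q0 by (simp add: degree_prod_eq_sum_degree)
  finally have "card {z. poly ?Q z = 0} = m"
    using Q by (simp add: degree_map_poly)
  moreover have "{z. poly ?Q z = 0} = complex_of_real ` {x. poly Q x = 0}"
  proof (intro equalityI subsetI)
    fix z assume z: "z \<in> {z. poly ?Q z = 0}"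
    with real have "z = complex_of_real (Re z)" by (simp add: complex_eq_iff)
    then obtain x where x: "z = complex_of_real x" by blast
    from z have "poly Q x = 0" by (simp add: x)
    with x show "z \<in> complex_of_real ` {x. poly Q x = 0}" by blast
  qed auto
  ultimately show ?thesis
    by (simp add: card_image inj_on_def)
qed

section \<open>Hankel forms\<close>

lemma mom_mult:
  assumes "degree p \<le> n" "degree q \<le> n"
  shows "mom c (p * q) = (\<Sum>j\<le>n. \<Sum>k\<le>n. c (j + k) * coeff p k * coeff q j)"
proof -
  have "p * q = (\<Sum>j\<le>n. Polynomial.smult (coeff q j) (p * Polynomial.monom 1 j))"
  proof -
    have "q = (\<Sum>i\<le>n. Polynomial.smult (coeff q i) (Polynomial.monom 1 i))"
      using assms by (simp add: smult_monom poly_as_sum_of_monoms')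
    then show ?thesis
      by (metis (no_types, lifting) mult_smult_right sum.cong sum_distrib_left)
  qed
  then have "mom c (p * q) = (\<Sum>j\<le>n. coeff q j * (\<Sum>k\<le>degree p. coeff p k * c (j + k)))"
    by (simp add: mom_sum mom_smult mom_monom_mult)
  also have "\<dots> = (\<Sum>j\<le>n. coeff q j * (\<Sum>k\<le>n. coeff p k * c (j + k)))"
    using assms
    by (intro sum.cong refl arg_cong[where f = "\<lambda>x. _ * x"] sum.mono_neutral_left)
      (auto simp: coeff_eq_0)
  finally show ?thesis
    by (simp add: sum_distrib_left mult_ac)
qed

definition poly_of :: "nat \<Rightarrow> (nat \<Rightarrow> real) \<Rightarrow> real poly" where
  "poly_of n f = (\<Sum>i\<le>n. Polynomial.monom (f i) i)"

lemma degree_poly_of: "degree (poly_of n f) \<le> n"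
  unfolding poly_of_def
  by (intro degree_sum_le) (auto intro: order_trans[OF degree_monom_le])

lemma coeff_poly_of: "coeff (poly_of n f) i = (if i \<le> n then f i else 0)"
  by (simp add: poly_of_def coeff_sum if_distrib cong: if_cong)

text \<open>The mixed terms cancel because Hankel matrices are symmetric, so a complex vector
  contributes the real forms of its real and imaginary parts. Hermitian non-negativity thus reduces
  to real polynomials.\<close>

lemma hermitian_form:
  fixes x y :: "nat \<Rightarrow> real"
  shows "(\<Sum>j\<le>n. \<Sum>k\<le>n. complex_of_real (c (j + k)) * Complex (x k) (y k) * cnj (Complex (x j) (y j))) =
    complex_of_real (mom c (poly_of n x * poly_of n x) + mom c (poly_of n y * poly_of n y))"
proof -
  have "(\<Sum>j\<le>n. \<Sum>k\<le>n. c (j + k) * (y k * x j)) = (\<Sum>j\<le>n. \<Sum>k\<le>n. c (j + k) * (x k * y j))"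
    by (subst sum.swap) (simp add: add.commute mult.commute)
  then show ?thesis
    by (simp add: complex_eq_iff mom_mult[OF degree_poly_of degree_poly_of] coeff_poly_of
        algebra_simps sum.distrib sum_subtractf)
qed

lemma nonneg_mat_hankel_iff:
  "nonneg_mat (map_mat complex_of_real (hankel c n)) \<longleftrightarrow> (\<forall>p. degree p \<le> n \<longrightarrow> mom c (p * p) \<ge> 0)"
proof -
  let ?A = "map_mat complex_of_real (hankel c n)"
  have A: "square_mat ?A" "mat_adjoint ?A = ?A"
    by (auto simp: hankel_def mat_adjoint_def mat_of_rows_def conjugate_complex_def add.commute intro!: eq_matI)
  have form: "(?A *\<^sub>v v) \<bullet>c v =
      (\<Sum>j\<le>n. \<Sum>k\<le>n. complex_of_real (c (j + k)) * (v $ k) * cnj (v $ j))"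
    if "v \<in> carrier_vec (n + 1)" for v
    using that
    by (simp add: scalar_prod_def hankel_def atLeast0LessThan lessThan_Suc_atMost sum_distrib_right
        conjugate_complex_def)
  show ?thesis
  proof (intro iffI allI impI)
    fix p :: "real poly" assume nn: "nonneg_mat ?A" and p: "degree p \<le> n"
    let ?v = "Matrix.vec (n + 1) (\<lambda>i. complex_of_real (coeff p i))"
    have "dim_row ?A = n + 1" by (simp add: hankel_def)
    then have "0 \<le> (?A *\<^sub>v ?v) \<bullet>c ?v"
      using nn unfolding nonneg_mat_def by auto
    also have "(?A *\<^sub>v ?v) \<bullet>c ?v = complex_of_real (mom c (p * p))"
      by (subst form) (auto simp: mom_mult[OF p p])
    finally show "mom c (p * p) \<ge> 0" by (simp add: less_eq_complex_def)
  next
    assume nn: "\<forall>p. degree p \<le> n \<longrightarrow> mom c (p * p) \<ge> 0"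
    have "0 \<le> (?A *\<^sub>v v) \<bullet>c v" if v: "v \<in> carrier_vec (n + 1)" for v
    proof -
      let ?x = "poly_of n (\<lambda>i. Re (v $ i))" and ?y = "poly_of n (\<lambda>i. Im (v $ i))"
      have "(?A *\<^sub>v v) \<bullet>c v = complex_of_real (mom c (?x * ?x) + mom c (?y * ?y))"
        unfolding form[OF v] hermitian_form[symmetric] by simp
      then show ?thesis
        using nn degree_poly_of by (simp add: less_eq_complex_def)
    qed
    with A show "nonneg_mat ?A"
      by (simp add: nonneg_mat_def hankel_def)
  qed
qed

lemma hankel_carrier: "hankel c n \<in> carrier_mat (n + 1) (n + 1)"
  by (simp add: hankel_def)

text \<open>A null vector of a non-negative form lies in its kernel, so a nonzero p with B(p^2) = 0
  would make the Hankel matrix singular.\<close>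

lemma pos_up_toI_det:
  assumes nonneg: "\<And>p. degree p \<le> n \<Longrightarrow> mom c (p * p) \<ge> 0"
    and det: "Determinant.det (hankel c n) \<noteq> 0"
  shows "pos_up_to c n"
  unfolding pos_up_to_def
proof (intro allI impI)
  fix p :: "real poly" assume p: "p \<noteq> 0 \<and> degree p \<le> n"
  have "mom c (p * p) \<noteq> 0"
  proof
    assume zero: "mom c (p * p) = 0"
    have orth: "mom c (p * q) = 0" if q: "degree q \<le> n" for q
    proof -
      \<comment> \<open>This is non-negativity on the square of a p + q. The left side is affine in
        \<open>a\<close>, because the quadratic term vanishes; the choice of \<open>a\<close> below
        gives it the value -1.\<close>
      have ineq: "2 * a * mom c (p * q) + mom c (q * q) \<ge> 0" for a
      proof -
        have "degree (Polynomial.smult a p + q) \<le> n"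
          using p q by (intro degree_add_le order_trans[OF degree_smult_le]) auto
        then have "mom c ((Polynomial.smult a p + q) * (Polynomial.smult a p + q)) \<ge> 0"
          by (rule nonneg)
        also have "(Polynomial.smult a p + q) * (Polynomial.smult a p + q) =
            Polynomial.smult (a * a) (p * p) + Polynomial.smult a (p * q) + Polynomial.smult a (p * q) + q * q"
          by (simp only: ring_distribs mult_smult_left mult_smult_right smult_smult mult_ac add_ac)
        finally show ?thesis by (simp only: mom_add mom_smult zero)
      qed
      show ?thesis
      proof (rule ccontr)
        assume "mom c (p * q) \<noteq> 0"
        then have "2 * (- (mom c (q * q) + 1) / (2 * mom c (p * q))) * mom c (p * q) = - (mom c (q * q) + 1)"
          by (simp add: field_simps)
        with ineq[of "- (mom c (q * q) + 1) / (2 * mom c (p * q))"] show False by linarith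
      qed
    qed
    let ?v = "Matrix.vec (n + 1) (coeff p)"
    have "hankel c n *\<^sub>v ?v = 0\<^sub>v (n + 1)"
    proof (rule eq_vecI)
      fix i assume "i < dim_vec (0\<^sub>v (n + 1))"
      then have i: "i \<le> n" by simp
      have "(\<Sum>k\<le>n. c (i + k) * coeff p k) = mom c (p * Polynomial.monom 1 i)"
        unfolding mom_monom_mult using p
        by (intro sum.mono_neutral_cong_right) (auto simp: coeff_eq_0)
      also have "\<dots> = 0"
        using i by (intro orth order_trans[OF degree_monom_le])
      finally have "(\<Sum>k\<le>n. c (i + k) * coeff p k) = 0" .
      moreover have "(hankel c n *\<^sub>v ?v) $ i = (\<Sum>k\<le>n. c (i + k) * coeff p k)"
        using i by (simp add: scalar_prod_def hankel_def atLeast0LessThan lessThan_Suc_atMost)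
      ultimately show "(hankel c n *\<^sub>v ?v) $ i = 0\<^sub>v (n + 1) $ i"
        using i by simp
    qed (simp add: hankel_def)
    moreover have "?v \<noteq> 0\<^sub>v (n + 1)"
    proof
      assume "?v = 0\<^sub>v (n + 1)"
      then have "?v $ degree p = 0\<^sub>v (n + 1) $ degree p" by (rule arg_cong)
      moreover have "degree p < n + 1" using p by simp
      ultimately have "lead_coeff p = 0" by (simp only: index_vec index_zero_vec)
      with p show False by simp
    qed
    ultimately have "Determinant.det (hankel c n) = 0"
      using det_0_iff_vec_prod_zero[of "hankel c n" "n + 1"] vec_carrier[of "n + 1" "coeff p"]
        hankel_carrier[of c n] by blast
    with det show False by simp
  qed
  with nonneg p show "mom c (p * p) > 0" by (simp add: order.not_eq_order_implies_strict)
qed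

section \<open>Gauss quadrature\<close>

definition lagrange :: "real set \<Rightarrow> real \<Rightarrow> real poly" where
  "lagrange A a = (\<Prod>x\<in>A - {a}. Polynomial.smult (1 / (a - x)) [:- x, 1:])"

lemma poly_lagrange:
  assumes "finite A" "a \<in> A" "x \<in> A"
  shows "poly (lagrange A a) x = (if x = a then 1 else 0)"
  using assms by (auto simp: lagrange_def poly_prod divide_simps)

lemma degree_lagrange:
  assumes "finite A" "a \<in> A"
  shows "degree (lagrange A a) \<le> card A - 1"
proof -
  have "degree (lagrange A a) \<le> (\<Sum>x\<in>A - {a}. degree (Polynomial.smult (1 / (a - x)) [:- x, 1:]))"
    unfolding lagrange_def using assms
    by (intro order_trans[OF degree_prod_sum_le]) (simp_all only: o_def finite_Diff order_refl)
  also have "\<dots> \<le> (\<Sum>x\<in>A - {a}. 1)"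
    by (intro sum_mono order_trans[OF degree_smult_le]) auto
  finally show ?thesis using assms by simp
qed

text \<open>The remainder modulo N vanishes on A but has degree below the size of A, so it is
  zero.\<close>

lemma card_roots_dvd:
  fixes N p :: "real poly"
  assumes "degree N = card A" "N \<noteq> 0" "finite A" "\<And>a. a \<in> A \<Longrightarrow> poly N a = 0"
    and "\<And>a. a \<in> A \<Longrightarrow> poly p a = 0"
  shows "N dvd p"
proof -
  have "p mod N = 0"
  proof (rule ccontr)
    assume nz: "p mod N \<noteq> 0"
    have "poly (p mod N) a = 0" if "a \<in> A" for a
      using assms(4,5)[OF that] poly_mod[of N a p] by simp
    then have "A \<subseteq> {a. poly (p mod N) a = 0}" by blast
    then have "card A \<le> card {a. poly (p mod N) a = 0}"
      using poly_roots_finite[OF nz] by (intro card_mono)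
    also have "\<dots> \<le> degree (p mod N)" using nz by (rule poly_roots_degree)
    also have "\<dots> < degree N"
      using degree_mod_less[OF assms(2), of p] nz by simp
    finally show False using assms(1) by simp
  qed
  then show ?thesis by (simp add: dvd_eq_mod_eq_0)
qed

text \<open>The error of Lagrange interpolation at the nodes is N s with degree s < m, which the
  functional annihilates. The weights are positive since exactness applies to the squares of the
  Lagrange polynomials, of degree at most 2m.\<close>

lemma gauss_quadrature:
  assumes b: "pos_up_to b m" and N: "degree N = m + 1" and A: "card A = m + 1"
    and roots: "\<And>a. a \<in> A \<Longrightarrow> poly N a = 0"
    and orth: "\<And>s. degree s < m \<Longrightarrow> mom b (N * s) = 0"
  shows "\<forall>a\<in>A. mom b (lagrange A a) > 0"
    and "degree p \<le> 2 * m \<Longrightarrow> mom b p = (\<Sum>a\<in>A. mom b (lagrange A a) * poly p a)"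
proof -
  have A': "finite A" using A card_ge_0_finite by force
  have N0: "N \<noteq> 0" using N by auto
  have m: "mom b (N * s) = 0" if "degree (N * s) \<le> 2 * m" for s
  proof (cases "s = 0")
    case False
    then have "degree s < m"
      using that N N0 by (simp add: degree_mult_eq)
    then show ?thesis by (rule orth)
  qed simp
  have quad: "mom b p = (\<Sum>a\<in>A. mom b (lagrange A a) * poly p a)" if p: "degree p \<le> 2 * m" for p
  proof -
    let ?r = "\<Sum>a\<in>A. Polynomial.smult (poly p a) (lagrange A a)"
    have "poly (p - ?r) x = 0" if "x \<in> A" for x
    proof -
      have "poly ?r x = (\<Sum>a\<in>A. if x = a then poly p a else 0)"
        unfolding poly_sum using A' that by (intro sum.cong) (auto simp: poly_lagrange)
      also have "\<dots> = poly p x" using A' that by simp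
      finally show ?thesis by simp
    qed
    then have "N dvd p - ?r"
      using card_roots_dvd[OF _ N0 A' roots, of "p - ?r"] A N by metis
    then obtain s where s: "p - ?r = N * s" by (rule dvdE)
    have "degree (lagrange A a) \<le> 2 * m" if "a \<in> A" for a
      using degree_lagrange[OF A' that] A by simp
    then have "degree ?r \<le> 2 * m"
      using A' by (intro degree_sum_le order_trans[OF degree_smult_le]) auto
    with p have "degree (N * s) \<le> 2 * m" unfolding s[symmetric] by (intro degree_diff_le)
    then have "mom b (p - ?r) = 0" unfolding s by (rule m)
    then show ?thesis by (simp add: mom_diff mom_sum mom_smult mult.commute)
  qed
  then show "degree p \<le> 2 * m \<Longrightarrow> mom b p = (\<Sum>a\<in>A. mom b (lagrange A a) * poly p a)" .
  show "\<forall>a\<in>A. mom b (lagrange A a) > 0"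
  proof
    fix a assume a: "a \<in> A"
    let ?l = "lagrange A a"
    have l: "degree ?l \<le> m" using degree_lagrange[OF A' a] A by simp
    have "?l \<noteq> 0" using poly_lagrange[OF A' a a] by auto
    then have "0 < mom b (?l * ?l)" using l by (rule pos_up_toD[OF b])
    also have "\<dots> = (\<Sum>x\<in>A. mom b (lagrange A x) * poly (?l * ?l) x)"
      using l by (intro quad order_trans[OF degree_mult_le]) simp
    also have "\<dots> = (\<Sum>x\<in>A. if x = a then mom b (lagrange A x) else 0)"
      using A' a by (intro sum.cong) (auto simp: poly_lagrange)
    also have "\<dots> = mom b ?l" using A' a by simp
    finally show "0 < mom b ?l" .
  qed
qed

section \<open>Solutions of the truncated Hausdorff problem\<close>

text \<open>For a measure concentrated on [0, L], the integrands restricted to the half-line and to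
  the interval agree almost everywhere.\<close>

lemma stieltjes_solution_iff_hausdorff_solution:
  "stieltjes_solution b m M \<and> emeasure M (- {0..L}) = 0 \<longleftrightarrow> hausdorff_solution L b m M"
proof -
  have ?thesis if M [measurable_cong]: "sets M = sets borel" and null: "emeasure M (- {0..L}) = 0"
  proof -
    have "AE t in M. t \<in> {0..L}"
      using M null by (intro AE_I'[of "- {0..L}"]) (auto simp: null_sets_def)
    then have eq: "AE t in M. indicator {0..} t *\<^sub>R t ^ k = (indicator {0..L} t *\<^sub>R t ^ k :: real)" for k
      by eventually_elim (simp add: indicator_def)
    have "set_integrable M {0..} (\<lambda>t. t ^ k) \<longleftrightarrow> set_integrable M {0..L} (\<lambda>t. t ^ k :: real)" for k
      unfolding set_integrable_def by (rule integrable_cong_AE[OF _ _ eq]) measurable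
    moreover have "(LINT t:{0..}|M. t ^ k) = (LINT t:{0..L}|M. t ^ k :: real)" for k
      unfolding set_lebesgue_integral_def by (rule integral_cong_AE[OF _ _ eq]) measurable
    moreover have "emeasure M (- {0..}) = 0"
    proof -
      have "emeasure M (- {0..}) \<le> emeasure M (- {0..L})"
        using M by (intro emeasure_mono) auto
      with null show ?thesis by simp
    qed
    ultimately show ?thesis
      using M null by (simp add: stieltjes_solution_def hausdorff_solution_def)
  qed
  then show ?thesis
    by (auto simp: stieltjes_solution_def hausdorff_solution_def)
qed

lemma hausdorff_solution_poly:
  assumes "hausdorff_solution L b m M" "degree p \<le> 2 * m"
  shows "integrable M (\<lambda>t. indicator {0..L} t * poly p t)"
    and "(LINT t|M. indicator {0..L} t * poly p t) = mom b p"
proof -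
  have eq: "(\<lambda>t. indicator {0..L} t * poly p t) =
      (\<lambda>t. \<Sum>i\<le>2 * m. coeff p i * (indicator {0..L} t * t ^ i))"
    by (simp add: poly_sum_atMost[OF assms(2)] sum_distrib_left mult_ac)
  have int: "integrable M (\<lambda>t. indicator {0..L} t * t ^ i)" "(LINT t|M. indicator {0..L} t * t ^ i) = b i"
    if "i \<le> 2 * m" for i
    using assms(1) that
    by (auto simp: hausdorff_solution_def set_integrable_def set_lebesgue_integral_def)
  show "integrable M (\<lambda>t. indicator {0..L} t * poly p t)"
    unfolding eq using int by (intro Bochner_Integration.integrable_sum integrable_mult_right) auto
  show "(LINT t|M. indicator {0..L} t * poly p t) = mom b p"
    unfolding eq mom_altdef[OF assms(2)]
    using int by (subst Bochner_Integration.integral_sum) (auto intro!: integrable_mult_right)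
qed

lemma hausdorff_solution_nonneg:
  assumes "hausdorff_solution L b m M" "degree p \<le> 2 * m" "\<And>t. 0 \<le> t \<Longrightarrow> t \<le> L \<Longrightarrow> poly p t \<ge> 0"
  shows "mom b p \<ge> 0"
  unfolding hausdorff_solution_poly(2)[OF assms(1,2), symmetric]
  using assms(3) by (intro integral_nonneg) (auto simp: indicator_def)

lemma hausdorff_solution_AE_zero:
  assumes M: "hausdorff_solution L b m M" and p: "degree p \<le> 2 * m"
    and nonneg: "\<And>t. 0 \<le> t \<Longrightarrow> t \<le> L \<Longrightarrow> poly p t \<ge> 0" and zero: "mom b p = 0"
  shows "AE t in M. t \<in> {0..L} \<and> poly p t = 0"
proof -
  have "sets M = sets borel" "emeasure M (- {0..L}) = 0"
    using M by (auto simp: hausdorff_solution_def)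
  then have "AE t in M. t \<in> {0..L}"
    by (intro AE_I'[of "- {0..L}"]) (auto simp: null_sets_def)
  moreover have "AE t in M. indicator {0..L} t * poly p t = 0"
    using integral_nonneg_eq_0_iff_AE[OF hausdorff_solution_poly(1)[OF M p]]
      hausdorff_solution_poly(2)[OF M p] nonneg zero
    by (auto simp: indicator_def)
  ultimately show ?thesis
    by eventually_elim auto
qed

text \<open>On the support, the indicator of a node coincides with its Lagrange polynomial, whose
  degree is at most 2m; hence the moments determine the mass.\<close>

lemma hausdorff_solution_emeasure_node:
  assumes M: "hausdorff_solution L b m M" and A: "finite A" "card A \<le> 2 * m + 1" "A \<subseteq> {0..L}"
    and supp: "AE t in M. t \<in> A" and a: "a \<in> A"
  shows "emeasure M {a} = ennreal (mom b (lagrange A a))"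
proof -
  have sets [measurable_cong]: "sets M = sets borel"
    using M by (simp add: hausdorff_solution_def)
  have l: "degree (lagrange A a) \<le> 2 * m"
    using degree_lagrange[OF A(1) a] A(2) by simp
  have ae: "AE t in M. indicator {0..L} t * poly (lagrange A a) t = indicator {a} t"
    using supp
  proof eventually_elim
    case (elim t)
    then show ?case
      using A a by (cases "t = a") (auto simp: poly_lagrange)
  qed
  have meas: "(\<lambda>t. indicator {0..L} t * poly (lagrange A a) t) \<in> borel_measurable M"
    using hausdorff_solution_poly(1)[OF M l] by (rule borel_measurable_integrable)
  have ind: "(\<lambda>t. indicator {a} t :: real) \<in> borel_measurable M" by measurable
  have "integrable M (\<lambda>t. indicator {a} t :: real)"
    using integrable_cong_AE[OF meas ind ae] hausdorff_solution_poly(1)[OF M l] by simp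
  then have "emeasure M {a} < \<infinity>"
    by (simp add: integrable_indicator_iff sets_eq_imp_space_eq[OF sets])
  moreover have "measure M {a} = mom b (lagrange A a)"
    using integral_cong_AE[OF meas ind ae] hausdorff_solution_poly(2)[OF M l]
    by (simp add: sets_eq_imp_space_eq[OF sets])
  ultimately show ?thesis
    by (simp add: emeasure_eq_ennreal_measure)
qed

lemma hausdorff_solution_unique:
  assumes M: "hausdorff_solution L b m M" and N: "hausdorff_solution L b m N"
    and A: "finite A" "card A \<le> 2 * m + 1" "A \<subseteq> {0..L}"
    and supp: "AE t in M. t \<in> A" "AE t in N. t \<in> A"
  shows "M = N"
proof (rule measure_eqI)
  have sM: "sets M = sets borel" and sN: "sets N = sets borel"
    using M N by (auto simp: hausdorff_solution_def)
  then show "sets M = sets N" by simp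
  have em: "emeasure K X = (\<Sum>a\<in>X \<inter> A. emeasure K {a})"
    if "sets K = sets borel" "AE t in K. t \<in> A" "X \<in> sets borel" for K :: "real measure" and X
  proof -
    have "finite (X \<inter> A)" using A by simp
    then have "X \<inter> A \<in> sets K" using that(1) by (simp add: finite_imp_closed)
    have "emeasure K X = emeasure K (X \<inter> A)"
      using that \<open>X \<inter> A \<in> sets K\<close> by (intro emeasure_eq_AE) auto
    also have "\<dots> = (\<Sum>a\<in>X \<inter> A. emeasure K {a})"
      using A that(1) by (intro emeasure_eq_sum_singleton) auto
    finally show ?thesis .
  qed
  fix X assume "X \<in> sets M"
  then have X: "X \<in> sets borel" using sM by simp
  show "emeasure M X = emeasure N X"
    unfolding em[OF sM supp(1) X] em[OF sN supp(2) X]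
    using hausdorff_solution_emeasure_node[OF M A supp(1)]
      hausdorff_solution_emeasure_node[OF N A supp(2)]
    by (intro sum.cong) (simp_all only: Int_iff)
qed

text \<open>\<open>point_measure\<close> lives on the subsets of \<open>A\<close>; the push-forward
  along the identity turns it into a Borel measure on the whole line, as
  \<open>hausdorff_solution\<close> demands.\<close>

definition atomic_measure :: "real set \<Rightarrow> (real \<Rightarrow> real) \<Rightarrow> real measure" where
  "atomic_measure A w = distr (point_measure A (\<lambda>a. ennreal (w a))) borel (\<lambda>x. x)"

lemma emeasure_atomic_measure:
  assumes "finite A" "X \<in> sets borel"
  shows "emeasure (atomic_measure A w) X = (\<Sum>a\<in>X \<inter> A. ennreal (w a))"
  unfolding atomic_measure_def using assms
  by (subst emeasure_distr) (auto simp: space_point_measure emeasure_point_measure_finite)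

lemma atomic_measure_hausdorff_solution:
  assumes A: "finite A" "A \<subseteq> {0..L}" and w: "\<And>a. a \<in> A \<Longrightarrow> w a \<ge> 0"
    and quad: "\<And>p. degree p \<le> 2 * m \<Longrightarrow> mom b p = (\<Sum>a\<in>A. w a * poly p a)"
  shows "hausdorff_solution L b m (atomic_measure A w)"
proof -
  let ?P = "point_measure A (\<lambda>a. ennreal (w a))"
  have "- {0..L} \<inter> A = {}" using A by auto
  then have "emeasure (atomic_measure A w) (- {0..L}) = 0"
    using A by (simp add: emeasure_atomic_measure)
  moreover have "set_integrable (atomic_measure A w) {0..L} (\<lambda>t. t ^ k)"
    "(LINT t:{0..L}|atomic_measure A w. t ^ k) = b k" if "k \<le> 2 * m" for k
  proof -
    show "set_integrable (atomic_measure A w) {0..L} (\<lambda>t. t ^ k)"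
      unfolding set_integrable_def atomic_measure_def using A
      by (subst integrable_distr_eq) (auto intro!: integrable_point_measure_finite)
    have "(LINT t:{0..L}|atomic_measure A w. t ^ k) = (LINT t|?P. indicator {0..L} t *\<^sub>R t ^ k)"
      unfolding set_lebesgue_integral_def atomic_measure_def
      by (subst integral_distr) auto
    also have "\<dots> = (\<Sum>a\<in>A. w a * (indicator {0..L} a * a ^ k))"
      using A w by (subst lebesgue_integral_point_measure_finite) auto
    also have "\<dots> = (\<Sum>a\<in>A. w a * poly (Polynomial.monom 1 k) a)"
      using A by (intro sum.cong) (auto simp: indicator_def poly_monom)
    also have "\<dots> = mom b (Polynomial.monom 1 k)"
      using that by (intro quad[symmetric] order_trans[OF degree_monom_le])
    finally show "(LINT t:{0..L}|atomic_measure A w. t ^ k) = b k"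
      by (simp add: mom_monom)
  qed
  ultimately show ?thesis
    by (simp add: hausdorff_solution_def atomic_measure_def)
qed

section \<open>Gauss--Radau quadrature\<close>

text \<open>Split t - x = (t - z) + (z - x): the first part contributes Q p, which is annihilated.
  Choosing x as an endpoint of the interval locates z relative to it.\<close>

lemma orthogonal_poly_root_cofactor:
  assumes c: "pos_up_to c (m - 1)" and Q: "degree Q = m" "m \<ge> 1"
    and orth: "\<And>s. degree s < m \<Longrightarrow> mom c (Q * s) = 0"
    and z: "poly Q z = 0"
  obtains p where "Q = [:- z, 1:] * p" "degree p \<le> m - 1" "mom c (p * p) > 0"
    "\<And>x. mom c ([:- x, 1:] * (p * p)) = (z - x) * mom c (p * p)"
proof -
  obtain p where p: "Q = [:- z, 1:] * p"
    using z by (metis poly_eq_0_iff_dvd dvdE)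
  have "p \<noteq> 0" using Q p by auto
  then have deg: "degree p = m - 1"
    using Q p degree_mult_eq[of "[:- z, 1:]" p] by auto
  then have pos: "mom c (p * p) > 0"
    by (intro pos_up_toD[OF c \<open>p \<noteq> 0\<close>]) simp
  have "mom c ([:- x, 1:] * (p * p)) = (z - x) * mom c (p * p)" for x
  proof -
    have "[:- x, 1:] = [:- z, 1:] + [:z - x:]" by simp
    then have "[:- x, 1:] * (p * p) = Q * p + Polynomial.smult (z - x) (p * p)"
      by (simp only: p ring_distribs mult_ac) simp
    moreover have "mom c (Q * p) = 0"
      using deg Q by (intro orth) simp
    ultimately show ?thesis by (simp add: mom_add mom_smult)
  qed
  with that p deg pos show thesis by simp
qed

text \<open>Orthogonality of Q for the weight k (t - r) is orthogonality of (t - r) Q for B, so r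
  can be prescribed as a node. The factor \<open>k\<close> is 1 for r = 0 and -1 for r = L, making
  the weight non-negative on [0, L].\<close>

lemma radau_quadrature:
  assumes b: "pos_up_to b m" and m: "m \<ge> 1" and k: "k \<noteq> 0"
    and mom_c: "\<And>p. mom c p = mom b (Polynomial.smult k [:- r, 1:] * p)"
    and c: "pos_up_to c (m - 1)" and Q: "degree Q = m"
    and orth: "\<And>s. degree s < m \<Longrightarrow> mom c (Q * s) = 0"
  defines "A \<equiv> insert r {x. poly Q x = 0}"
  shows "finite A" and "card A = m + 1"
    and "\<forall>a\<in>A. mom b (lagrange A a) > 0"
    and "degree p \<le> 2 * m \<Longrightarrow> mom b p = (\<Sum>a\<in>A. mom b (lagrange A a) * poly p a)"
proof -
  have Q0: "Q \<noteq> 0" using Q m by auto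
  \<comment> \<open>If Q = (t - r) p, then orthogonality to p reads k B(Q^2) = 0, against
    positivity. So r is an additional node and there are m + 1 of them.\<close>
  have "poly Q r \<noteq> 0"
  proof
    assume "poly Q r = 0"
    from orthogonal_poly_root_cofactor[OF c Q m orth this]
    obtain p where p: "Q = [:- r, 1:] * p" "degree p \<le> m - 1"
      by metis
    then have "mom c (Q * p) = 0" using m by (intro orth) simp
    moreover have "mom c (Q * p) = k * mom b (Q * Q)"
      unfolding mom_c mom_smult[symmetric]
      by (rule arg_cong[where f = "mom b"])
        (simp only: p(1) mult_smult_left mult_smult_right mult_ac)
    moreover have "mom b (Q * Q) > 0"
      using Q Q0 by (intro pos_up_toD[OF b]) auto
    ultimately show False using k by simp
  qed
  then have r: "r \<notin> {x. poly Q x = 0}" by simp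
  show "finite A" using poly_roots_finite[OF Q0] by (simp add: A_def)
  show card: "card A = m + 1"
    using r poly_roots_finite[OF Q0] orthogonal_poly_card_roots[OF c Q m orth]
    by (simp add: A_def)
  let ?N = "[:- r, 1:] * Q"
  have N: "degree ?N = m + 1"
    using Q Q0 by (subst degree_mult_eq) auto
  have roots: "poly ?N a = 0" if "a \<in> A" for a
    using that by (auto simp: A_def)
  have "mom b (?N * s) = 0" if "degree s < m" for s
  proof -
    have "k * mom b (?N * s) = mom c (Q * s)"
      unfolding mom_c mom_smult[symmetric]
      by (rule arg_cong[where f = "mom b"])
        (simp only: mult_smult_left mult_smult_right mult_ac)
    with orth[OF that] k show ?thesis by simp
  qed
  from gauss_quadrature[OF b N card roots this]
  show "\<forall>a\<in>A. mom b (lagrange A a) > 0"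
    and "degree p \<le> 2 * m \<Longrightarrow> mom b p = (\<Sum>a\<in>A. mom b (lagrange A a) * poly p a)"
    by blast+
qed

lemma poly_pos_beyond_roots:
  fixes p :: "real poly"
  assumes "lead_coeff p > 0" "\<And>z. poly p z = 0 \<Longrightarrow> z \<le> x" "x < y"
  shows "poly p y > 0"
proof (rule ccontr)
  assume "\<not> poly p y > 0"
  with assms(2)[of y] assms(3) have neg: "poly p y < 0" by force
  obtain n where n: "\<forall>t\<ge>n. poly p t \<ge> lead_coeff p"
    using poly_pinfty_gt_lc[OF assms(1)] by blast
  let ?t = "max n (y + 1)"
  have "poly p ?t > 0" using n assms(1) by (meson less_le_trans max.cobounded1)
  with neg obtain z where "y < z" "poly p z = 0"
    using poly_IVT_pos[of y ?t p] by (auto simp: max_def split: if_splits)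
  with assms(2,3) show False by force
qed

text \<open>The sequence on the left has Hankel matrix L Gamma_(m-1) - Gamma^(1)_(m-1), whose
  non-negativity thereby becomes that of B for the weight L - t.\<close>

lemma mom_upper_shift:
  "mom (\<lambda>k. L * b k - b (k + 1)) p = mom b ([:L, - 1:] * p)"
proof (rule mom_moments_of_linear)
  fix k
  have "[:L, - 1:] * Polynomial.monom 1 k = Polynomial.monom L k - Polynomial.monom 1 (k + 1)"
    by (simp add: monom_Suc smult_monom minus_monom)
  then show "L * b k - b (k + 1) = mom b ([:L, - 1:] * Polynomial.monom 1 k)"
    by (simp only: mom_diff mom_monom mult_1)
qed

section \<open>The orthogonal polynomial F for the weight t and its relation to the quotient\<close>

definition radau_poly :: "(nat \<Rightarrow> real) \<Rightarrow> nat \<Rightarrow> real poly" where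
  "radau_poly b m = Polynomial.smult (Delta (shift b) (int m - 1)) (hankel_poly b m) -
     Polynomial.smult (Delta b (int m)) (hankel_poly (shift b) (m - 1))"

text \<open>For the weight t, both D_m and D^1_(m-1) pair with s to a multiple of its coefficient at
  t^(m-1); the two multiples cancel in F.\<close>

lemma radau_poly_orthogonal:
  assumes "m \<ge> 1" "degree s < m"
  shows "mom (shift b) (radau_poly b m * s) = 0"
proof -
  have m: "int m - 1 = int (m - 1)" using assms by simp
  have "mom (shift b) (hankel_poly b m * s) = mom b (hankel_poly b m * pCons 0 s)"
    by (simp add: mom_shift)
  also have "\<dots> = coeff s (m - 1) * Delta b (int m)"
    using assms by (subst mom_hankel_poly) (auto simp: coeff_pCons split: nat.split)
  finally have "mom (shift b) (hankel_poly b m * s) = coeff s (m - 1) * Delta b (int m)" .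
  moreover have "mom (shift b) (hankel_poly (shift b) (m - 1) * s) =
      coeff s (m - 1) * Delta (shift b) (int m - 1)"
    unfolding m using assms by (intro mom_hankel_poly) simp
  ultimately show ?thesis
    by (simp add: radau_poly_def left_diff_distrib mom_diff mom_smult)
qed

context
  fixes b :: "nat \<Rightarrow> real" and m :: nat
  assumes pos: "pos_up_to b m" and pos_shift: "pos_up_to (shift b) (m - 1)"
    and m: "m \<ge> 1"
begin

lemma Deltas_pos:
  "Delta b (int m) > 0" "Delta b (int m - 1) > 0"
  "Delta (shift b) (int m - 1) > 0" "Delta (shift b) (int m - 2) > 0"
  using m by (auto intro: Delta_pos[OF pos] Delta_pos[OF pos_shift])

lemma degree_hankel_poly_m: "degree (hankel_poly b m) = m"
  using pos by (rule degree_hankel_poly) simp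

lemma lead_hankel_poly_pos: "lead_coeff (hankel_poly b m) > 0"
  unfolding degree_hankel_poly_m lead_coeff_hankel_poly by (rule Deltas_pos)

lemma coeff_radau_poly_pos: "coeff (radau_poly b m) m > 0"
proof -
  have "coeff (hankel_poly (shift b) (m - 1)) m = 0"
    using degree_hankel_poly_le[of "shift b" "m - 1"] m by (intro coeff_eq_0) linarith
  then show ?thesis
    using Deltas_pos by (simp add: radau_poly_def lead_coeff_hankel_poly)
qed

lemma degree_radau_poly: "degree (radau_poly b m) = m"
proof (rule antisym)
  show "degree (radau_poly b m) \<le> m"
    unfolding radau_poly_def
    using degree_hankel_poly_le[of b m] degree_hankel_poly_le[of "shift b" "m - 1"]
    by (intro degree_diff_le order_trans[OF degree_smult_le]) auto
  show "m \<le> degree (radau_poly b m)"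
    using coeff_radau_poly_pos by (intro le_degree) simp
qed

lemma poly_ratio_eq:
  "poly_ratio b m x = Delta b (int m) * poly (hankel_poly (shift b) (m - 1)) x /
     (Delta (shift b) (int m - 1) * poly (hankel_poly b m) x)"
proof -
  \<comment> \<open>The separate case k = 0 of \<open>orth_poly\<close> fits the general formula
    because \<open>Delta c (- 1) = 1\<close>.\<close>
  have op: "orth_poly c k x = poly (hankel_poly c k) x / sqrt (Delta c (int k) * Delta c (int k - 1))"
    for c k
  proof (cases "k = 0")
    case True
    then show ?thesis
      by (simp add: orth_poly_def Delta_def poly_hankel_poly bordered_def hankel_def det_single)
  next
    case False
    then show ?thesis
      by (simp add: orth_poly_def poly_hankel_poly bordered_def)
  qed
  have i: "int (m - 1) = int m - 1" using m by simp
  define d d' e e' where defs: "d = Delta b (int m)" "d' = Delta b (int m - 1)"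
    "e = Delta (shift b) (int m - 1)" "e' = Delta (shift b) (int m - 2)"
  have p: "d > 0" "d' > 0" "e > 0" "e' > 0" using Deltas_pos by (auto simp: defs)
  \<comment> \<open>The prefactor of the quotient and the two normalising square roots combine to
    Delta_m / Delta^1_(m-1).\<close>
  have s: "sqrt (d * e' / (d' * e)) * sqrt (d * d') / sqrt (e * e') = d / e"
  proof -
    have "sqrt (d * e' / (d' * e)) * sqrt (d * d') / sqrt (e * e') =
        sqrt (d * e' / (d' * e) * (d * d') / (e * e'))"
      by (simp add: real_sqrt_mult real_sqrt_divide)
    also have "d * e' / (d' * e) * (d * d') / (e * e') = (d / e) ^ 2"
      using p by (simp add: field_simps power2_eq_square)
    finally show ?thesis using p by simp
  qed
  have "poly_ratio b m x = sqrt (d * e' / (d' * e)) * sqrt (d * d') / sqrt (e * e') *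
      (poly (hankel_poly (shift b) (m - 1)) x / poly (hankel_poly b m) x)"
    unfolding poly_ratio_def op i by (simp add: defs)
  then show ?thesis
    unfolding s by (simp add: defs)
qed

lemma poly_ratio_radau:
  assumes "poly (hankel_poly b m) x > 0"
  shows "poly_ratio b m x \<le> 1 \<longleftrightarrow> poly (radau_poly b m) x \<ge> 0"
    and "poly_ratio b m x = 1 \<longleftrightarrow> poly (radau_poly b m) x = 0"
  unfolding poly_ratio_eq radau_poly_def using assms Deltas_pos
  by (auto simp: divide_le_eq divide_eq_eq)

end

section \<open>Position of the zeros of D_m and F relative to [0, L]\<close>

lemma degree_interval_gram:
  fixes p :: "real poly"
  assumes m: "m \<ge> 1" and p: "degree p \<le> m - 1"
  shows "degree ([:0, 1:] * ([:L, - 1:] * (p * p))) \<le> 2 * m"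
    and "degree ([:L, - 1:] * (p * p)) \<le> 2 * m"
proof -
  have 1: "degree ([:L, - 1:] * (p * p)) \<le> 2 * m - 1"
    using degree_mult_le[of "[:L, - 1:]" "p * p"] degree_mult_le[of p p] p m
    by (simp del: mult_pCons_left)
  then show "degree ([:L, - 1:] * (p * p)) \<le> 2 * m" by linarith
  show "degree ([:0, 1:] * ([:L, - 1:] * (p * p))) \<le> 2 * m"
    using degree_mult_le[of "[:0, 1:]" "[:L, - 1:] * (p * p)"] 1 m
    by (simp del: mult_pCons_left)
qed

lemma gram_nonneg_interval:
  assumes M: "hausdorff_solution L b m M" and m: "m \<ge> 1" and p: "degree p \<le> m - 1"
  shows "mom b ([:0, 1:] * ([:L, - 1:] * (p * p))) \<ge> 0"
    and "mom b ([:L, - 1:] * (p * p)) \<ge> 0"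
proof -
  show "mom b ([:0, 1:] * ([:L, - 1:] * (p * p))) \<ge> 0"
    using degree_interval_gram(1)[OF m p] by (intro hausdorff_solution_nonneg[OF M]) (simp_all only: poly_mult, auto intro!: mult_nonneg_nonneg)
  show "mom b ([:L, - 1:] * (p * p)) \<ge> 0"
    using degree_interval_gram(2)[OF m p] by (intro hausdorff_solution_nonneg[OF M]) (simp_all only: poly_mult, auto intro!: mult_nonneg_nonneg)
qed

context
  fixes b :: "nat \<Rightarrow> real" and m :: nat and L :: real
  assumes pos: "pos_up_to b m" and pos_shift: "pos_up_to (shift b) (m - 1)"
    and m: "m \<ge> 1" and L: "L > 0"
begin

lemmas radau_degree = degree_radau_poly[OF pos pos_shift m]
lemmas radau_orth = radau_poly_orthogonal[OF m]

lemma radau_root_cofactor: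
  assumes "poly (radau_poly b m) z = 0"
  obtains p where "radau_poly b m = [:- z, 1:] * p" "degree p \<le> m - 1" "mom (shift b) (p * p) > 0"
    "\<And>x. mom b ([:0, 1:] * ([:- x, 1:] * (p * p))) = (z - x) * mom (shift b) (p * p)"
  using orthogonal_poly_root_cofactor[OF pos_shift radau_degree m radau_orth assms] unfolding mom_shift by metis

text \<open>For F = (t - z) p and x = 0 the cofactor identity reads B(t^2 p^2) = z B(t p^2), with
  both values of B positive.\<close>

lemma radau_root_pos:
  assumes "poly (radau_poly b m) z = 0"
  shows "z > 0"
proof -
  obtain p where p: "radau_poly b m = [:- z, 1:] * p" "degree p \<le> m - 1" "mom (shift b) (p * p) > 0"
    "\<And>x. mom b ([:0, 1:] * ([:- x, 1:] * (p * p))) = (z - x) * mom (shift b) (p * p)"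
    using radau_root_cofactor[OF assms] by metis
  have "p \<noteq> 0" using p(3) by auto
  then have "mom b (([:0, 1:] * p) * ([:0, 1:] * p)) > 0"
    using p(2) m by (intro pos_up_toD[OF pos]) auto
  also have "([:0, 1:] * p) * ([:0, 1:] * p) = [:0, 1:] * ([:- 0, 1:] * (p * p))"
    by (simp only: mult_ac minus_zero)
  finally show ?thesis
    using p(3) by (simp only: p(4)) (simp add: zero_less_mult_iff)
qed

lemma hankel_root_cofactor:
  assumes "poly (hankel_poly b m) z = 0"
  obtains p where "hankel_poly b m = [:- z, 1:] * p" "degree p \<le> m - 1" "mom b (p * p) > 0"
    "\<And>x. mom b ([:- x, 1:] * (p * p)) = (z - x) * mom b (p * p)"
proof -
  have "pos_up_to b (m - 1)" using pos by (auto simp: pos_up_to_def)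
  moreover have "mom b (hankel_poly b m * s) = 0" if "degree s < m" for s
    using that by (simp add: mom_hankel_poly coeff_eq_0)
  ultimately show thesis
    using orthogonal_poly_root_cofactor[OF _ degree_hankel_poly_m[OF pos pos_shift m] m _ assms, of b] that
    by metis
qed

text \<open>A zero z of D_m = (t - z) p satisfies B((L - t) p^2) = (L - z) B(p^2), hence z <= L.
  Only the matrix condition enters, so this serves both directions of the equivalence.\<close>

lemma hankel_poly_pos_beyond:
  assumes form: "\<And>p. degree p \<le> m - 1 \<Longrightarrow> mom b ([:L, - 1:] * (p * p)) \<ge> 0" and x: "L < x"
  shows "poly (hankel_poly b m) x > 0"
proof (rule poly_pos_beyond_roots[OF lead_hankel_poly_pos[OF pos pos_shift m] _ x])
  fix z assume "poly (hankel_poly b m) z = 0"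
  then obtain p where p: "degree p \<le> m - 1" "mom b (p * p) > 0"
    "\<And>x. mom b ([:- x, 1:] * (p * p)) = (z - x) * mom b (p * p)"
    using hankel_root_cofactor by metis
  have "[:L, - 1:] * (p * p) = - ([:- L, 1:] * (p * p))" by simp
  then have "mom b ([:L, - 1:] * (p * p)) = - ((z - L) * mom b (p * p))"
    by (simp only: mom_minus p(3))
  with form[OF p(1)] have "(z - L) * mom b (p * p) \<le> 0" by simp
  with p(2) show "z \<le> L" by (simp add: mult_le_0_iff)
qed

text \<open>This rules out that \<open>poly_ratio b m L\<close> is merely the default value 0 of a
  division by zero.\<close>

lemma hankel_poly_pos_at:
  assumes M: "hausdorff_solution L b m M"
  shows "poly (hankel_poly b m) L > 0"
proof -
  let ?P = "hankel_poly b m"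
  have "poly ?P L \<noteq> 0"
  proof
    assume "poly ?P L = 0"
    then obtain p where p: "?P = [:- L, 1:] * p" "degree p \<le> m - 1" "mom b (p * p) > 0"
      "\<And>x. mom b ([:- x, 1:] * (p * p)) = (L - x) * mom b (p * p)"
      using hankel_root_cofactor by metis
    \<comment> \<open>From t (L - t) = - L (t - L) - (t - L)^2. The first term contributes 0 and the
      second - B(D_m^2) < 0, whereas a solution on [0, L] makes the left side non-negative under
      B.\<close>
    have "[:0, 1:] * ([:L, - 1:] * (p * p)) = - Polynomial.smult L ([:- L, 1:] * (p * p)) - ?P * ?P"
    proof -
      have "[:0, 1:] * [:L, - 1:] = - Polynomial.smult L [:- L, 1:] - [:- L, 1:] * [:- L, 1:]"
        by simp
      then have "[:0, 1:] * [:L, - 1:] * (p * p) =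
          (- Polynomial.smult L [:- L, 1:] - [:- L, 1:] * [:- L, 1:]) * (p * p)"
        by (rule arg_cong)
      then show ?thesis
        by (simp only: p(1) left_diff_distrib right_diff_distrib mult_minus_left mult_minus_right
            mult_smult_left mult_smult_right mult_ac)
    qed
    then have "mom b ([:0, 1:] * ([:L, - 1:] * (p * p))) = - mom b (?P * ?P)"
      using p(4)[of L] by (simp only: mom_diff mom_minus mom_smult) simp
    moreover have "mom b (?P * ?P) > 0"
      using degree_hankel_poly_m[OF pos pos_shift m] m by (intro pos_up_toD[OF pos]) auto
    ultimately show False
      using gram_nonneg_interval(1)[OF M m p(2)] by linarith
  qed
  moreover have "poly ?P L \<ge> 0"
  proof (rule ccontr)
    assume "\<not> poly ?P L \<ge> 0"
    moreover have "poly ?P (L + 1) > 0"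
      using gram_nonneg_interval(2)[OF M m] by (intro hankel_poly_pos_beyond) auto
    ultimately obtain x where "L < x" "poly ?P x = 0"
      using poly_IVT_pos[of L "L + 1" ?P] by auto
    with hankel_poly_pos_beyond gram_nonneg_interval(2)[OF M m] show False
      by (metis less_irrefl)
  qed
  ultimately show ?thesis by simp
qed

lemma radau_root_le_of_solution:
  assumes M: "hausdorff_solution L b m M" and z: "poly (radau_poly b m) z = 0"
  shows "z \<le> L"
proof -
  obtain p where p: "degree p \<le> m - 1" "mom (shift b) (p * p) > 0"
    "\<And>x. mom b ([:0, 1:] * ([:- x, 1:] * (p * p))) = (z - x) * mom (shift b) (p * p)"
    using radau_root_cofactor[OF z] by metis
  have "[:0, 1:] * ([:L, - 1:] * (p * p)) = - ([:0, 1:] * ([:- L, 1:] * (p * p)))" by simp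
  then have "mom b ([:0, 1:] * ([:L, - 1:] * (p * p))) = - ((z - L) * mom (shift b) (p * p))"
    by (simp only: mom_minus p(3))
  with gram_nonneg_interval(1)[OF M m p(1)] have "(z - L) * mom (shift b) (p * p) \<le> 0" by simp
  with p(2) show ?thesis by (simp add: mult_le_0_iff)
qed

lemma poly_ratio_le_of_solution:
  assumes M: "hausdorff_solution L b m M" and x: "x \<ge> L"
  shows "poly_ratio b m x \<le> 1"
proof -
  let ?F = "radau_poly b m"
  have F: "poly ?F y > 0" if "y > L" for y
  proof (rule poly_pos_beyond_roots[OF _ _ that])
    show "lead_coeff ?F > 0"
      unfolding radau_degree by (rule coeff_radau_poly_pos[OF pos pos_shift m])
  qed (rule radau_root_le_of_solution[OF M])
  have "poly ?F L \<ge> 0"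
  proof (rule ccontr)
    assume "\<not> poly ?F L \<ge> 0"
    then obtain y where "L < y" "poly ?F y = 0"
      using poly_IVT_pos[of L "L + 1" ?F] F[of "L + 1"] by auto
    with F[of y] show False by simp
  qed
  then have "poly ?F x \<ge> 0" using F[of x] x by (cases "x = L") auto
  moreover have "poly (hankel_poly b m) x > 0"
    using hankel_poly_pos_at[OF M] hankel_poly_pos_beyond[OF gram_nonneg_interval(2)[OF M m], of x] x
    by (cases "x = L") auto
  ultimately show ?thesis
    using poly_ratio_radau(1)[OF pos pos_shift m] by blast
qed

text \<open>Since D_m > 0 beyond L, the bound on the quotient means F >= 0 there. A zero of F beyond
  L would be a local minimum, hence a multiple zero, but all zeros of F are simple.\<close>

lemma radau_root_le_of_ratio:
  assumes form: "\<And>p. degree p \<le> m - 1 \<Longrightarrow> mom b ([:L, - 1:] * (p * p)) \<ge> 0"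
    and ratio: "\<And>x. x \<ge> L \<Longrightarrow> poly_ratio b m x \<le> 1" and z: "poly (radau_poly b m) z = 0"
  shows "z \<le> L"
proof (rule ccontr)
  assume "\<not> z \<le> L"
  then have zL: "0 < z - L" by simp
  let ?F = "radau_poly b m"
  have "poly ?F x \<ge> 0" if "x > L" for x
    using poly_ratio_radau(1)[OF pos pos_shift m hankel_poly_pos_beyond[OF form that]] ratio[of x] that
    by simp
  then have "\<forall>y. \<bar>z - y\<bar> < z - L \<longrightarrow> poly ?F z \<le> poly ?F y"
    unfolding z by (auto simp: abs_if split: if_splits)
  then have "poly (pderiv ?F) z = 0"
    using zL by (intro DERIV_local_min[OF poly_DERIV])
  then show False
    using orthogonal_poly_simple_root[OF pos_shift radau_degree m radau_orth z] by blast
qed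

section \<open>The two Gauss--Radau solutions, with prescribed node 0 or L, and uniqueness\<close>

abbreviation "lower_nodes \<equiv> insert 0 {x. poly (radau_poly b m) x = 0}"
abbreviation "lower_solution \<equiv> atomic_measure lower_nodes (\<lambda>a. mom b (lagrange lower_nodes a))"

lemma lower_quadrature:
  shows "finite lower_nodes" and "card lower_nodes = m + 1"
    and "\<forall>a\<in>lower_nodes. mom b (lagrange lower_nodes a) > 0"
    and "degree p \<le> 2 * m \<Longrightarrow>
      mom b p = (\<Sum>a\<in>lower_nodes. mom b (lagrange lower_nodes a) * poly p a)"
proof -
  have "mom (shift b) p = mom b (Polynomial.smult 1 [:- 0, 1:] * p)" for p
    by (simp add: mom_shift)
  note radau_quadrature[OF pos m _ this pos_shift radau_degree radau_orth]
  then show "finite lower_nodes" "card lower_nodes = m + 1"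
    "\<forall>a\<in>lower_nodes. mom b (lagrange lower_nodes a) > 0"
    "degree p \<le> 2 * m \<Longrightarrow>
      mom b p = (\<Sum>a\<in>lower_nodes. mom b (lagrange lower_nodes a) * poly p a)"
    by simp_all
qed

lemma lower_nodes_subset:
  assumes "\<And>z. poly (radau_poly b m) z = 0 \<Longrightarrow> z \<le> L"
  shows "lower_nodes \<subseteq> {0..L}"
  using assms less_imp_le[OF radau_root_pos] less_imp_le[OF L] by auto

lemma lower_solution:
  assumes "\<And>z. poly (radau_poly b m) z = 0 \<Longrightarrow> z \<le> L"
  shows "hausdorff_solution L b m lower_solution"
proof (rule atomic_measure_hausdorff_solution)
  show "lower_nodes \<subseteq> {0..L}" using assms by (rule lower_nodes_subset)
qed (use lower_quadrature in \<open>auto intro: less_imp_le\<close>)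

text \<open>The quadrature with node 0 evaluates B((L - t) p^2) as a sum of non-negative terms. As
  all nodes lie below L, it vanishes only if p has m + 1 zeros, impossible for degree at most m -
  1.\<close>

lemma upper_shift_pos:
  assumes root: "\<And>z. poly (radau_poly b m) z = 0 \<Longrightarrow> z < L"
  shows "pos_up_to (\<lambda>k. L * b k - b (k + 1)) (m - 1)"
  unfolding pos_up_to_def mom_upper_shift
proof (intro allI impI)
  fix p :: "real poly" assume p: "p \<noteq> 0 \<and> degree p \<le> m - 1"
  have lt: "a < L" if "a \<in> lower_nodes" for a
    using that root L by auto
  have deg: "degree ([:L, - 1:] * (p * p)) \<le> 2 * m"
    using p m by (intro degree_interval_gram) auto
  have "\<exists>a\<in>lower_nodes. poly p a \<noteq> 0"
  proof (rule ccontr)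
    assume "\<not> (\<exists>a\<in>lower_nodes. poly p a \<noteq> 0)"
    then have "lower_nodes \<subseteq> {x. poly p x = 0}" by blast
    then have "card lower_nodes \<le> card {x. poly p x = 0}"
      using p by (intro card_mono poly_roots_finite) auto
    also have "\<dots> \<le> degree p" using p by (intro poly_roots_degree) auto
    finally show False using lower_quadrature(2) p by linarith
  qed
  then obtain a where a: "a \<in> lower_nodes" "poly p a \<noteq> 0" by blast
  have "0 < (\<Sum>a\<in>lower_nodes. mom b (lagrange lower_nodes a) * ((L - a) * (poly p a * poly p a)))"
  proof (rule sum_pos2[OF lower_quadrature(1) a(1)])
    have "0 < poly p a * poly p a" using a(2) by (meson not_square_less_zero linorder_neqE_linordered_idom mult_eq_0_iff)
    moreover have "0 < mom b (lagrange lower_nodes a)" "0 < L - a"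
      using lower_quadrature(3) lt[OF a(1)] a(1) by auto
    ultimately show "0 < mom b (lagrange lower_nodes a) * ((L - a) * (poly p a * poly p a))"
      by (metis mult_pos_pos)
    fix x assume "x \<in> lower_nodes"
    then show "0 \<le> mom b (lagrange lower_nodes x) * ((L - x) * (poly p x * poly p x))"
      using lower_quadrature(3) lt[of x] by (intro mult_nonneg_nonneg zero_le_square) (auto intro: less_imp_le)
  qed
  also have "\<dots> = mom b ([:L, - 1:] * (p * p))"
    unfolding lower_quadrature(4)[OF deg] by (simp add: algebra_simps)
  finally show "0 < mom b ([:L, - 1:] * (p * p))" .
qed

text \<open>The same quadrature for the weight L - t. Its positive mass at L distinguishes it from
  \<open>lower_solution\<close>, which has no node there.\<close>

lemma upper_solution:
  assumes root: "\<And>z. poly (radau_poly b m) z = 0 \<Longrightarrow> z < L"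
  obtains M where "hausdorff_solution L b m M" "emeasure M {L} > 0"
proof -
  define c where "c = (\<lambda>k. L * b k - b (k + 1))"
  note mom_c = mom_upper_shift[of L b, folded c_def]
  let ?Q = "hankel_poly c m"
  let ?A = "insert L {x. poly ?Q x = 0}"
  let ?M = "atomic_measure ?A (\<lambda>a. mom b (lagrange ?A a))"
  have M: "hausdorff_solution L b m lower_solution"
    using root by (intro lower_solution) (auto intro: less_imp_le)
  have c: "pos_up_to c (m - 1)"
    unfolding c_def using root by (rule upper_shift_pos)
  have "m \<le> Suc (m - 1)" by simp
  with c have Q: "degree ?Q = m" by (rule degree_hankel_poly)
  have orth: "mom c (?Q * s) = 0" if "degree s < m" for s
    using that by (simp add: mom_hankel_poly coeff_eq_0)
  have "mom c p = mom b (Polynomial.smult (- 1) [:- L, 1:] * p)" for p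
    by (simp add: mom_c)
  note quad = radau_quadrature[OF pos m _ this c Q orth]
  have "hausdorff_solution L b m ?M"
  proof (rule atomic_measure_hausdorff_solution)
    have "0 \<le> z \<and> z \<le> L" if z: "poly ?Q z = 0" for z
    proof -
      from orthogonal_poly_root_cofactor[OF c Q m orth z]
      obtain p where p: "degree p \<le> m - 1" "mom c (p * p) > 0"
        "\<And>x. mom c ([:- x, 1:] * (p * p)) = (z - x) * mom c (p * p)"
        by blast
      \<comment> \<open>Lower bound for z: z c(p^2) = B(t (L - t) p^2), which is non-negative
        because \<open>lower_solution\<close> already represents B on [0, L].\<close>
      have "mom c ([:- 0, 1:] * (p * p)) = mom b ([:0, 1:] * ([:L, - 1:] * (p * p)))"
        unfolding mom_c by (simp only: mult_ac minus_zero)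
      with gram_nonneg_interval(1)[OF M m p(1)] have "(z - 0) * mom c (p * p) \<ge> 0"
        unfolding p(3) by simp
      \<comment> \<open>Upper bound for z: (z - L) c(p^2) is minus the value of B on the square of
        (L - t) p.\<close>
      moreover have "mom c ([:- L, 1:] * (p * p)) \<le> 0"
      proof -
        let ?q = "[:L, - 1:] * p"
        have "[:- L, 1:] = - [:L, - 1:]" by simp
        then have "[:L, - 1:] * ([:- L, 1:] * (p * p)) = - (?q * ?q)"
          by (simp only: mult_minus_left mult_minus_right mult_ac)
        moreover have "mom b (?q * ?q) \<ge> 0"
          using degree_mult_le[of "[:L, - 1:]" p] p(1) m
          by (intro pos_up_to_nonneg[OF pos]) simp
        ultimately show ?thesis
          by (simp only: mom_c mom_minus)
      qed
      then have "(z - L) * mom c (p * p) \<le> 0" unfolding p(3) .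
      ultimately show ?thesis using p(2) by (simp add: mult_le_0_iff zero_le_mult_iff)
    qed
    then show "?A \<subseteq> {0..L}" using L by auto
  qed (use quad in \<open>auto intro: less_imp_le\<close>)
  moreover have "emeasure ?M {L} > 0"
    using quad by (subst emeasure_atomic_measure) auto
  ultimately show thesis by (rule that)
qed

lemma solution_unique_iff:
  assumes root: "\<And>z. poly (radau_poly b m) z = 0 \<Longrightarrow> z \<le> L"
  shows "(\<exists>!M. hausdorff_solution L b m M) \<longleftrightarrow> poly (radau_poly b m) L = 0"
proof
  assume F: "poly (radau_poly b m) L = 0"
  then obtain p where p: "radau_poly b m = [:- L, 1:] * p" "degree p \<le> m - 1"
    "\<And>x. mom b ([:0, 1:] * ([:- x, 1:] * (p * p))) = (L - x) * mom (shift b) (p * p)"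
    using radau_root_cofactor by metis
  let ?g = "[:0, 1:] * ([:L, - 1:] * (p * p))"
  have "?g = - ([:0, 1:] * ([:- L, 1:] * (p * p)))" by simp
  then have zero: "mom b ?g = 0" by (simp only: mom_minus p(3)) simp
  have deg: "degree ?g \<le> 2 * m"
    using p m by (intro degree_interval_gram) auto
  \<comment> \<open>The polynomial t (L - t) p^2 is non-negative on [0, L] and B vanishes on it, so
    each solution sits on its zeros: 0, L and the zeros of p. All of them are nodes.\<close>
  have supp: "AE t in M. t \<in> lower_nodes" if "hausdorff_solution L b m M" for M
  proof -
    have "AE t in M. t \<in> {0..L} \<and> poly ?g t = 0"
      by (rule hausdorff_solution_AE_zero[OF that deg _ zero])
        (simp only: poly_mult, auto intro!: mult_nonneg_nonneg)
    then show ?thesis by eventually_elim (auto simp: p(1))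
  qed
  have "lower_nodes \<subseteq> {0..L}" using root by (rule lower_nodes_subset)
  moreover have "card lower_nodes \<le> 2 * m + 1" using lower_quadrature(2) by linarith
  ultimately have "M = N" if "hausdorff_solution L b m M" "hausdorff_solution L b m N" for M N
    using hausdorff_solution_unique[OF that lower_quadrature(1)] supp that by blast
  with lower_solution[OF root] show "\<exists>!M. hausdorff_solution L b m M" by blast
next
  assume ex1: "\<exists>!M. hausdorff_solution L b m M"
  show "poly (radau_poly b m) L = 0"
  proof (rule ccontr)
    assume nz: "poly (radau_poly b m) L \<noteq> 0"
    then have "z < L" if "poly (radau_poly b m) z = 0" for z
      using root[OF that] that by (cases "z = L") auto
    then obtain M where M: "hausdorff_solution L b m M" "emeasure M {L} > 0"
      using upper_solution by blast
    have "emeasure lower_solution {L} = 0"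
      using nz L lower_quadrature(1) by (subst emeasure_atomic_measure) auto
    with M lower_solution[OF root] ex1 show False by (metis less_irrefl)
  qed
qed

end

section \<open>From the matrix hypotheses to positivity of the functionals, and the two
  equivalences\<close>

theorem theorem3p1:
  fixes L :: real and m :: nat and b :: "nat \<Rightarrow> real"
  assumes "0 < L" and "1 \<le> m"
    and det_pos: "Determinant.det (hankel b m) > 0"
    and a: "nonneg_mat (map_mat complex_of_real (hankel b m))"
    and b: "\<forall>r \<le> m - 1. \<forall>\<xi> :: nat \<Rightarrow> complex.
        (\<Sum>j = 0..r. \<Sum>k = 0..r. complex_of_real (b (j + k)) * \<xi> k * cnj (\<xi> j)) = 0 \<longrightarrow>
        (\<Sum>j = 0..r. \<Sum>k = 0..r. complex_of_real (b (j + k + 2)) * \<xi> k * cnj (\<xi> j)) = 0"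
    and c1: "nonneg_mat (map_mat complex_of_real (hankel (shift b) (m - 1)))"
    and c2: "\<forall>r \<le> m - 1. \<forall>\<xi> :: nat \<Rightarrow> complex.
        (\<Sum>j = 0..r. \<Sum>k = 0..r. complex_of_real (b (j + k + 1)) * \<xi> k * cnj (\<xi> j)) = 0 \<longrightarrow>
        (\<Sum>j = 0..r. \<Sum>k = 0..r. complex_of_real (b (j + k + 2)) * \<xi> k * cnj (\<xi> j)) = 0"
  shows
    "((\<exists>M. stieltjes_solution b m M \<and> emeasure M (- {0..L}) = 0) \<longleftrightarrow>
        nonneg_mat (map_mat complex_of_real (L \<cdot>\<^sub>m hankel b (m - 1) - hankel (shift b) (m - 1))) \<and>
        (\<forall>x \<ge> L. poly_ratio b m x \<le> 1)) \<and>
     ((\<exists>M. hausdorff_solution L b m M) \<longleftrightarrow>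
        nonneg_mat (map_mat complex_of_real (L \<cdot>\<^sub>m hankel b (m - 1) - hankel (shift b) (m - 1))) \<and>
        (\<forall>x \<ge> L. poly_ratio b m x \<le> 1)) \<and>
     (nonneg_mat (map_mat complex_of_real (L \<cdot>\<^sub>m hankel b (m - 1) - hankel (shift b) (m - 1))) \<and>
        (\<forall>x \<ge> L. poly_ratio b m x \<le> 1) \<longrightarrow>
        ((\<exists>!M. hausdorff_solution L b m M) \<longleftrightarrow> poly_ratio b m L = 1))"
proof -
  note L = \<open>0 < L\<close> and m = \<open>1 \<le> m\<close>
  let ?H = "nonneg_mat (map_mat complex_of_real (L \<cdot>\<^sub>m hankel b (m - 1) - hankel (shift b) (m - 1)))"
  let ?R = "\<forall>x \<ge> L. poly_ratio b m x \<le> 1"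
  have pos: "pos_up_to b m"
    using a det_pos unfolding nonneg_mat_hankel_iff by (intro pos_up_toI_det) auto
  have pos_shift: "pos_up_to (shift b) (m - 1)"
    unfolding pos_up_to_def
  proof (intro allI impI)
    fix p :: "real poly" assume p: "p \<noteq> 0 \<and> degree p \<le> m - 1"
    have form: "(\<Sum>j = 0..m - 1. \<Sum>k = 0..m - 1. complex_of_real (c (j + k)) *
        complex_of_real (coeff p k) * cnj (complex_of_real (coeff p j))) =
        complex_of_real (mom c (p * p))" for c
      using p by (simp add: mom_mult[of p "m - 1"] atLeast0AtMost)
    \<comment> \<open>The second half of condition c), applied to the real coefficient vector, would
      turn B(t p^2) = 0 into B((t p)^2) = 0, contradicting positivity up to degree m.\<close>
    have "mom (shift b) (p * p) \<noteq> 0"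
    proof
      assume "mom (shift b) (p * p) = 0"
      then have "mom (\<lambda>k. b (k + 2)) (p * p) = 0"
        using c2[rule_format, of "m - 1" "\<lambda>k. complex_of_real (coeff p k)"]
          form[of "shift b"] form[of "\<lambda>k. b (k + 2)"] by (simp add: shift_def)
      moreover have "mom (\<lambda>k. b (k + 2)) (p * p) = mom b (([:0, 1:] * p) * ([:0, 1:] * p))"
      proof -
        have "(\<lambda>k. b (k + 2)) = shift (shift b)" by (simp add: shift_def fun_eq_iff)
        then show ?thesis by (simp add: mom_shift)
      qed
      moreover have "mom b (([:0, 1:] * p) * ([:0, 1:] * p)) > 0"
        using p m by (intro pos_up_toD[OF pos]) auto
      ultimately show False by simp
    qed
    moreover have "mom (shift b) (p * p) \<ge> 0"
      using c1 p unfolding nonneg_mat_hankel_iff by blast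
    ultimately show "mom (shift b) (p * p) > 0" by simp
  qed
  have "L \<cdot>\<^sub>m hankel b (m - 1) - hankel (shift b) (m - 1) = hankel (\<lambda>k. L * b k - b (k + 1)) (m - 1)"
    by (auto simp: hankel_def shift_def intro!: eq_matI)
  then have H: "?H \<longleftrightarrow> (\<forall>p. degree p \<le> m - 1 \<longrightarrow> mom b ([:L, - 1:] * (p * p)) \<ge> 0)"
    by (simp only: nonneg_mat_hankel_iff mom_upper_shift)
  have roots: "z \<le> L" if "?H \<and> ?R" "poly (radau_poly b m) z = 0" for z
    using that H by (intro radau_root_le_of_ratio[OF pos pos_shift m L]) blast+
  have hausdorff: "(\<exists>M. hausdorff_solution L b m M) \<longleftrightarrow> ?H \<and> ?R"
  proof
    assume "\<exists>M. hausdorff_solution L b m M"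
    then obtain M where M: "hausdorff_solution L b m M" by blast
    show "?H \<and> ?R"
      unfolding H
      using gram_nonneg_interval(2)[OF M m] poly_ratio_le_of_solution[OF pos pos_shift m L M] by blast
  next
    assume "?H \<and> ?R"
    then show "\<exists>M. hausdorff_solution L b m M"
      using lower_solution[OF pos pos_shift m L] roots by blast
  qed
  moreover have "(\<exists>!M. hausdorff_solution L b m M) \<longleftrightarrow> poly_ratio b m L = 1" if hyp: "?H \<and> ?R"
  proof -
    \<comment> \<open>Some solution is needed to know D_m(L) > 0, which translates equality of the
      quotient with 1 at L into F(L) = 0.\<close>
    obtain M where M: "hausdorff_solution L b m M" using hausdorff hyp by blast
    have "(\<exists>!M. hausdorff_solution L b m M) \<longleftrightarrow> poly (radau_poly b m) L = 0"
      using solution_unique_iff[OF pos pos_shift m L] roots[OF hyp] by blast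
    also have "\<dots> \<longleftrightarrow> poly_ratio b m L = 1"
      using poly_ratio_radau(2)[OF pos pos_shift m hankel_poly_pos_at[OF pos pos_shift m L M]] by blast
    finally show ?thesis .
  qed
  ultimately show ?thesis
    unfolding stieltjes_solution_iff_hausdorff_solution by blast
qed

end
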